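(* For all $k\geq 2$, the set $C_k\subset\mathbb{G}_k$ is semi-algebraic of codimension $2$.
   Context: Identify $\wedge^2\mathbb{R}^k$ with the space of $k\times k$ real skew-symmetric matrices, and let $\mathbb{G}_k=\mathbb{R}^k\oplus\wedge^2\mathbb{R}^k$, a real vector space of dimension $k(k+1)/2$ with points denoted $(x,Y)$. $C_k$ is the set of $(x,Y)\in\mathbb{G}_k$ with $Y\neq 0$ such that there exists $M\in\mathrm{O}(k)$, $M\neq\mathbb{1}$, with $Mx=x$, $MYM^*=Y$ ($^*$ = transpose) and $Mv=v$ for all $v\in\ker Y$. A subset of $\mathbb{R}^n$ is semi-algebraic if it is obtained by finitely many unions and intersections of sets of the form $\{f=0\}$, $\{g>0\}$ with $f,g$ polynomials on $\mathbb{R}^n$; dimension and codimension are in the sense of semi-algebraic sets (for a smooth semi-algebraic set this is the dimension as a manifold, and the dimension of a finite union is the maximum of the dimensions). *)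

theory Defs
  imports "HOL-Analysis.Analysis"
begin

section \<open>Semi-algebraic sets\<close>

text \<open>
  Semi-algebraic subsets of a linear subspace \<open>V\<close> of a Euclidean space.  The polynomials on \<open>V\<close> are
  the restrictions to \<open>V\<close> of the polynomials on the surrounding space.
\<close>

inductive semialgebraic_in :: "'a::euclidean_space set \<Rightarrow> 'a set \<Rightarrow> bool" for V where
  zero: "real_polynomial_function f \<Longrightarrow> semialgebraic_in V {x \<in> V. f x = 0}"
| pos: "real_polynomial_function g \<Longrightarrow> semialgebraic_in V {x \<in> V. g x > 0}"
| union: "semialgebraic_in V A \<Longrightarrow> semialgebraic_in V B \<Longrightarrow> semialgebraic_in V (A \<union> B)"
| inter: "semialgebraic_in V A \<Longrightarrow> semialgebraic_in V B \<Longrightarrow> semialgebraic_in V (A \<inter> B)"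

section \<open>Smooth submanifolds and dimension\<close>

text \<open>Class \<open>C\<^sup>n\<close> on an open set, by iterated directional derivatives of the Frechet derivative.\<close>

primrec Cn_on :: "nat \<Rightarrow> ('a::euclidean_space \<Rightarrow> 'b::euclidean_space) \<Rightarrow> 'a set \<Rightarrow> bool" where
  "Cn_on 0 f U \<longleftrightarrow> continuous_on U f"
| "Cn_on (Suc n) f U \<longleftrightarrow>
     (\<forall>x\<in>U. f differentiable (at x)) \<and> (\<forall>v. Cn_on n (\<lambda>x. frechet_derivative f (at x) v) U)"

definition smooth_on :: "'a::euclidean_space set \<Rightarrow> ('a \<Rightarrow> 'b::euclidean_space) \<Rightarrow> bool" where
  "smooth_on U f \<longleftrightarrow> (\<forall>n. Cn_on n f U)"

text \<open>
  Embedded submanifolds, by slice charts.  The subspace \<open>T\<close> plays the role of \<open>\<real>\<^sup>d\<close>.  The empty set is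
  a submanifold of every dimension.
\<close>

definition smooth_submanifold :: "nat \<Rightarrow> 'a::euclidean_space set \<Rightarrow> bool" where
  "smooth_submanifold d S \<longleftrightarrow>
     (\<forall>p\<in>S. \<exists>U V T \<phi> \<psi>. open U \<and> p \<in> U \<and> open V \<and> subspace T \<and> dim T = d \<and>
        homeomorphism U V \<phi> \<psi> \<and> smooth_on U \<phi> \<and> smooth_on V (\<psi> :: 'a \<Rightarrow> 'a) \<and>
        \<phi> ` (S \<inter> U) = V \<inter> T)"

text \<open>
  The dimension of a semi-algebraic set is the largest dimension of a nonempty smooth submanifold
  contained in it.  The lemmas \<open>has_sa_dim_smooth\<close>, \<open>has_sa_dim_Un\<close> and \<open>has_sa_dim_UN\<close> below show that
  this is the usual dimension: it is the manifold dimension for smooth sets, and the maximum of the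
  dimensions for a finite union of semi-algebraic sets.  The empty set has no dimension.
\<close>

definition has_sa_dim :: "'a::euclidean_space set \<Rightarrow> nat \<Rightarrow> bool" where
  "has_sa_dim A d \<longleftrightarrow>
     (\<exists>S. smooth_submanifold d S \<and> S \<noteq> {} \<and> S \<subseteq> A) \<and>
     (\<forall>e S. smooth_submanifold e S \<longrightarrow> S \<noteq> {} \<longrightarrow> S \<subseteq> A \<longrightarrow> e \<le> d)"

definition has_sa_codim_in :: "'a::euclidean_space set \<Rightarrow> 'a set \<Rightarrow> nat \<Rightarrow> bool" where
  "has_sa_codim_in V A c \<longleftrightarrow> (\<exists>d. has_sa_dim A d \<and> d + c = dim V)"

lemma smooth_submanifold_chart:
  fixes S :: "'a::euclidean_space set"
  assumes "smooth_submanifold d S" "p \<in> S"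
  obtains U V T and \<phi> \<psi> :: "'a \<Rightarrow> 'a" where "open U" "p \<in> U" "open V" "subspace T" "dim T = d"
    "homeomorphism U V \<phi> \<psi>" "smooth_on U \<phi>" "smooth_on V \<psi>" "\<phi> ` (S \<inter> U) = V \<inter> T"
  using assms(1)[unfolded smooth_submanifold_def, rule_format, OF assms(2)]
  by (elim exE conjE) rule

lemma smooth_submanifold_open_Int:
  fixes S :: "'a::euclidean_space set"
  assumes S: "smooth_submanifold d S" and W: "open W"
  shows "smooth_submanifold d (S \<inter> W)"
  unfolding smooth_submanifold_def
proof
  fix p assume p: "p \<in> S \<inter> W"
  then have "p \<in> S" by blast
  from S this obtain U V T and \<phi> \<psi> :: "'a \<Rightarrow> 'a"
    where c: "open U" "p \<in> U" "open V" "subspace T" "dim T = d" "homeomorphism U V \<phi> \<psi>"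
      "smooth_on U \<phi>" "smooth_on V \<psi>" "\<phi> ` (S \<inter> U) = V \<inter> T"
    by (rule smooth_submanifold_chart)
  have mono: "smooth_on B f" if "smooth_on A f" "B \<subseteq> A" for A B and f :: "'a \<Rightarrow> 'a"
  proof -
    have "Cn_on n f B" if "Cn_on n f A" for n and f :: "'a \<Rightarrow> 'a"
      using that
    proof (induction n arbitrary: f)
      case 0
      then show ?case using \<open>B \<subseteq> A\<close> by (simp add: continuous_on_subset[of A])
    next
      case (Suc n)
      then show ?case using \<open>B \<subseteq> A\<close> by (simp add: subset_iff)
    qed
    then show ?thesis using that(1) unfolding smooth_on_def by blast
  qed
  have inj: "inj_on \<phi> U"
    using c(6) by (intro inj_on_inverseI[where g = \<psi>]) (simp add: homeomorphism_apply1)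
  have img: "\<phi> ` (U \<inter> W) = V \<inter> \<psi> -` W" 
    using homeomorphism_apply1[OF c(6)] homeomorphism_image1[OF c(6)] by auto
  have oV: "open (V \<inter> \<psi> -` W)"
    by (rule continuous_open_preimage[OF homeomorphism_cont2[OF c(6)] c(3) W])
  have h: "homeomorphism (U \<inter> W) (V \<inter> \<psi> -` W) \<phi> \<psi>"
    by (rule homeomorphism_of_subsets[OF c(6) Int_lower1 Int_lower1 img])
  have "\<phi> ` (S \<inter> W \<inter> (U \<inter> W)) = \<phi> ` (S \<inter> U) \<inter> \<phi> ` (U \<inter> W)"
    using inj_on_image_Int[OF inj, of "S \<inter> U" "U \<inter> W"] by (simp add: Int_ac)
  also have "\<dots> = V \<inter> \<psi> -` W \<inter> T"
    unfolding img c(9) by blast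
  finally have "open (U \<inter> W) \<and> p \<in> U \<inter> W \<and> open (V \<inter> \<psi> -` W) \<and> subspace T \<and> dim T = d \<and>
      homeomorphism (U \<inter> W) (V \<inter> \<psi> -` W) \<phi> \<psi> \<and> smooth_on (U \<inter> W) \<phi> \<and>
      smooth_on (V \<inter> \<psi> -` W) \<psi> \<and> \<phi> ` (S \<inter> W \<inter> (U \<inter> W)) = V \<inter> \<psi> -` W \<inter> T"
    using c(1,2,4,5) p W oV h mono[OF c(7) Int_lower1, of W] mono[OF c(8) Int_lower1, of "\<psi> -` W"]
    by (simp add: open_Int)
  then show "\<exists>U V T \<phi> \<psi>. open U \<and> p \<in> U \<and> open V \<and> subspace T \<and> dim T = d \<and>
        homeomorphism U V \<phi> \<psi> \<and> smooth_on U \<phi> \<and> smooth_on V (\<psi> :: 'a \<Rightarrow> 'a) \<and>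
        \<phi> ` (S \<inter> W \<inter> U) = V \<inter> T"
    by - (rule exI[of _ "U \<inter> W"], rule exI[of _ "V \<inter> \<psi> -` W"], rule exI[of _ T],
        rule exI[of _ \<phi>], rule exI[of _ \<psi>], assumption)
qed

lemma smooth_submanifold_dim_mono:
  fixes S :: "'a::euclidean_space set"
  assumes S: "smooth_submanifold d S" and S': "smooth_submanifold e S'" and ne: "S' \<noteq> {}"
    and sub: "S' \<subseteq> S"
  shows "e \<le> d"
proof -
  obtain p where p: "p \<in> S'" using ne by blast
  have "p \<in> S" using p sub by blast
  from S this obtain U V T and \<phi> \<psi> :: "'a \<Rightarrow> 'a"
    where c: "open U" "p \<in> U" "open V" "subspace T" "dim T = d" "homeomorphism U V \<phi> \<psi>"
      "\<phi> ` (S \<inter> U) = V \<inter> T"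
    by (rule smooth_submanifold_chart)
  have "smooth_submanifold e (S' \<inter> U)"
    by (intro smooth_submanifold_open_Int S' c)
  moreover have "p \<in> S' \<inter> U" using p c(2) by blast
  ultimately obtain U' V' T' and \<phi>' \<psi>' :: "'a \<Rightarrow> 'a"
    where c': "open U'" "p \<in> U'" "open V'" "subspace T'" "dim T' = e" "homeomorphism U' V' \<phi>' \<psi>'"
      "\<phi>' ` (S' \<inter> U \<inter> U') = V' \<inter> T'"
    by (rule smooth_submanifold_chart)
  have im: "\<psi>' ` (V' \<inter> T') = S' \<inter> U \<inter> U'"
  proof -
    have "\<psi>' ` \<phi>' ` (S' \<inter> U \<inter> U') = (\<lambda>x. x) ` (S' \<inter> U \<inter> U')"
      unfolding image_image using c'(6) by (intro image_cong refl) (simp add: homeomorphism_apply1)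
    then show ?thesis using c'(7) by simp
  qed
  have "dim T' \<le> dim T"
  proof (rule invariance_of_dimension_subspaces)
    show "openin (top_of_set T') (V' \<inter> T')"
      using openin_open_Int[OF c'(3), of T'] by (simp add: Int_commute)
    show "continuous_on (V' \<inter> T') (\<phi> \<circ> \<psi>')"
    proof (rule continuous_on_compose)
      show "continuous_on (V' \<inter> T') \<psi>'"
        by (rule continuous_on_subset[OF homeomorphism_cont2[OF c'(6)]]) blast
      show "continuous_on (\<psi>' ` (V' \<inter> T')) \<phi>"
        unfolding im by (rule continuous_on_subset[OF homeomorphism_cont1[OF c(6)]]) blast
    qed
    show "\<phi> \<circ> \<psi>' \<in> V' \<inter> T' \<rightarrow> T"
    proof
      fix x assume "x \<in> V' \<inter> T'"
      then have "\<psi>' x \<in> S \<inter> U" using im sub by blast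
      then show "(\<phi> \<circ> \<psi>') x \<in> T" using c(7) by auto
    qed
    show "inj_on (\<phi> \<circ> \<psi>') (V' \<inter> T')"
    proof (rule comp_inj_on)
      show "inj_on \<psi>' (V' \<inter> T')"
        using c'(6) by (intro inj_on_inverseI[where g = \<phi>']) (simp add: homeomorphism_apply2)
      show "inj_on \<phi> (\<psi>' ` (V' \<inter> T'))"
        unfolding im using c(6) by (intro inj_on_inverseI[where g = \<psi>]) (simp add: homeomorphism_apply1)
    qed
    show "V' \<inter> T' \<noteq> {}" unfolding c'(7)[symmetric] using c'(2) p c(2) by blast
  qed (rule c(4) c'(4))+
  then show ?thesis using c(5) c'(5) by simp
qed

lemma has_sa_dim_unique: "has_sa_dim A d \<Longrightarrow> has_sa_dim A e \<Longrightarrow> d = e"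
  unfolding has_sa_dim_def by (elim conjE exE) (simp add: antisym)

lemma has_sa_dim_smooth: "smooth_submanifold d S \<Longrightarrow> S \<noteq> {} \<Longrightarrow> has_sa_dim S d"
  unfolding has_sa_dim_def by (intro conjI exI[of _ S] allI impI) (auto dest: smooth_submanifold_dim_mono)

lemma semialgebraic_locally_decided:
  assumes "subspace V" "semialgebraic_in V A" "S \<noteq> {}"
  shows "\<exists>W. open W \<and> S \<inter> W \<noteq> {} \<and> (S \<inter> W \<subseteq> A \<or> S \<inter> W \<inter> A = {})"
proof -
  define P where "P A \<longleftrightarrow> (\<forall>S. S \<noteq> {} \<longrightarrow>
    (\<exists>W. open W \<and> S \<inter> W \<noteq> {} \<and> (S \<inter> W \<subseteq> A \<or> S \<inter> W \<inter> A = {})))" for A :: "'a set"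
  have Popen: "P A" if "open A" for A
    unfolding P_def
  proof (intro allI impI)
    fix S :: "'a set" assume "S \<noteq> {}"
    show "\<exists>W. open W \<and> S \<inter> W \<noteq> {} \<and> (S \<inter> W \<subseteq> A \<or> S \<inter> W \<inter> A = {})"
    proof (cases "S \<inter> A = {}")
      case True
      then show ?thesis using \<open>S \<noteq> {}\<close> by (intro exI[of _ UNIV]) simp
    next
      case False
      then show ?thesis using that by (intro exI[of _ A]) simp
    qed
  qed
  have Pclosed: "P A" if "closed A" for A
    unfolding P_def
  proof (intro allI impI)
    fix S :: "'a set" assume "S \<noteq> {}"
    show "\<exists>W. open W \<and> S \<inter> W \<noteq> {} \<and> (S \<inter> W \<subseteq> A \<or> S \<inter> W \<inter> A = {})"
    proof (cases "S \<subseteq> A")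
      case True
      then show ?thesis using \<open>S \<noteq> {}\<close> by (intro exI[of _ UNIV]) simp
    next
      case False
      then have "S \<inter> - A \<noteq> {}" "S \<inter> - A \<inter> A = {}" by blast+
      then show ?thesis using that by (intro exI[of _ "- A"]) (simp add: open_Compl)
    qed
  qed
  have PUn: "P (A \<union> B)" and PInt: "P (A \<inter> B)" if "P A" "P B" for A B
  proof -
    have *: "\<exists>W. open W \<and> S \<inter> W \<noteq> {} \<and> (S \<inter> W \<subseteq> A \<or> S \<inter> W \<inter> A = {}) \<and>
        (S \<inter> W \<subseteq> B \<or> S \<inter> W \<inter> B = {})" if ne: "S \<noteq> {}" for S
    proof -
      obtain W where W: "open W" "S \<inter> W \<noteq> {}" "S \<inter> W \<subseteq> A \<or> S \<inter> W \<inter> A = {}"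
        using \<open>P A\<close>[unfolded P_def, rule_format, OF ne] by (elim exE conjE) rule
      obtain W' where W': "open W'" "S \<inter> W \<inter> W' \<noteq> {}" "S \<inter> W \<inter> W' \<subseteq> B \<or> S \<inter> W \<inter> W' \<inter> B = {}"
        using \<open>P B\<close>[unfolded P_def, rule_format, OF W(2)] by (elim exE conjE) rule
      have "open (W \<inter> W') \<and> S \<inter> (W \<inter> W') \<noteq> {} \<and>
          (S \<inter> (W \<inter> W') \<subseteq> A \<or> S \<inter> (W \<inter> W') \<inter> A = {}) \<and>
          (S \<inter> (W \<inter> W') \<subseteq> B \<or> S \<inter> (W \<inter> W') \<inter> B = {})"
      proof (intro conjI)
        show "open (W \<inter> W')" using W(1) W'(1) by (rule open_Int)
        show "S \<inter> (W \<inter> W') \<noteq> {}" using W'(2) by (simp add: Int_assoc)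
        show "S \<inter> (W \<inter> W') \<subseteq> A \<or> S \<inter> (W \<inter> W') \<inter> A = {}" using W(3) by fast
        show "S \<inter> (W \<inter> W') \<subseteq> B \<or> S \<inter> (W \<inter> W') \<inter> B = {}" using W'(3) by (simp add: Int_assoc)
      qed
      then show ?thesis by (rule exI)
    qed
    show "P (A \<union> B)" unfolding P_def
    proof (intro allI impI)
      fix S :: "'a set" assume "S \<noteq> {}"
      from *[OF this] obtain W where W: "open W" "S \<inter> W \<noteq> {}"
        "S \<inter> W \<subseteq> A \<or> S \<inter> W \<inter> A = {}" "S \<inter> W \<subseteq> B \<or> S \<inter> W \<inter> B = {}" by (elim exE conjE) rule
      have "S \<inter> W \<subseteq> A \<union> B \<or> S \<inter> W \<inter> (A \<union> B) = {}"
        using W(3,4) by fast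
      with W(1,2) show "\<exists>W. open W \<and> S \<inter> W \<noteq> {} \<and> (S \<inter> W \<subseteq> A \<union> B \<or> S \<inter> W \<inter> (A \<union> B) = {})"
        by (intro exI[of _ W] conjI)
    qed
    show "P (A \<inter> B)" unfolding P_def
    proof (intro allI impI)
      fix S :: "'a set" assume "S \<noteq> {}"
      from *[OF this] obtain W where W: "open W" "S \<inter> W \<noteq> {}"
        "S \<inter> W \<subseteq> A \<or> S \<inter> W \<inter> A = {}" "S \<inter> W \<subseteq> B \<or> S \<inter> W \<inter> B = {}" by (elim exE conjE) rule
      have "S \<inter> W \<subseteq> A \<inter> B \<or> S \<inter> W \<inter> (A \<inter> B) = {}"
        using W(3,4) by fast
      with W(1,2) show "\<exists>W. open W \<and> S \<inter> W \<noteq> {} \<and> (S \<inter> W \<subseteq> A \<inter> B \<or> S \<inter> W \<inter> (A \<inter> B) = {})"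
        by (intro exI[of _ W] conjI)
    qed
  qed
  have PV: "P V" by (intro Pclosed closed_subspace assms)
  have cont: "continuous_on UNIV f" if "real_polynomial_function f" for f :: "'a \<Rightarrow> real"
    using that by (simp add: continuous_at_imp_continuous_on continuous_real_polymonial_function)
  from assms(2) have "P A"
  proof induction
    case (zero f)
    have "{x \<in> V. f x = 0} = V \<inter> {x. f x = 0}" by blast
    moreover have "closed {x. f x = 0}"
      using cont[OF zero] by (intro closed_Collect_eq) auto
    ultimately show ?case using PInt[OF PV Pclosed] by simp
  next
    case (pos g)
    have "{x \<in> V. g x > 0} = V \<inter> {x. g x > 0}" by blast
    moreover have "open {x. g x > 0}"
      using cont[OF pos] by (intro open_Collect_less) auto
    ultimately show ?case using PInt[OF PV Popen] by simp
  next
    case (union A B)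
    then show ?case by (intro PUn)
  next
    case (inter A B)
    then show ?case by (intro PInt)
  qed
  from this[unfolded P_def, rule_format, OF assms(3)] show ?thesis .
qed

lemma has_sa_dim_Un:
  assumes V: "subspace V" and A: "semialgebraic_in V A"
    and dA: "has_sa_dim A a" and dB: "has_sa_dim B b"
  shows "has_sa_dim (A \<union> B) (max a b)"
  unfolding has_sa_dim_def
proof (intro conjI allI impI)
  obtain S S' where "smooth_submanifold a S" "S \<noteq> {}" "S \<subseteq> A" "smooth_submanifold b S'" "S' \<noteq> {}" "S' \<subseteq> B"
    using dA dB unfolding has_sa_dim_def by (elim conjE exE) rule
  then show "\<exists>S. smooth_submanifold (max a b) S \<and> S \<noteq> {} \<and> S \<subseteq> A \<union> B"
    by (cases "a \<le> b") (simp add: max_def, rule exI[of _ S'], blast, simp add: max_def, rule exI[of _ S], blast)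
next
  fix e S assume S: "smooth_submanifold e S" "S \<noteq> {}" "S \<subseteq> A \<union> B"
  obtain W where W: "open W" "S \<inter> W \<noteq> {}" "S \<inter> W \<subseteq> A \<or> S \<inter> W \<inter> A = {}"
    using semialgebraic_locally_decided[OF V A S(2)] by blast
  have "smooth_submanifold e (S \<inter> W)"
    using S(1) W(1) by (rule smooth_submanifold_open_Int)
  moreover have "S \<inter> W \<subseteq> A \<or> S \<inter> W \<subseteq> B" using W(3) S(3) by blast
  ultimately have "e \<le> a \<or> e \<le> b"
    using dA dB W(2) unfolding has_sa_dim_def by blast
  then show "e \<le> max a b" by auto
qed

lemma has_sa_dim_UN:
  assumes "finite I" "I \<noteq> {}" "subspace V"
    and "\<And>i. i \<in> I \<Longrightarrow> semialgebraic_in V (S i)"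
    and "\<And>i. i \<in> I \<Longrightarrow> smooth_submanifold (d i) (S i)" "\<And>i. i \<in> I \<Longrightarrow> S i \<noteq> {}"
  shows "has_sa_dim (\<Union>i\<in>I. S i) (Max (d ` I))"
  using assms
proof (induction rule: finite_ne_induct)
  case (singleton i)
  then show ?case by (simp add: has_sa_dim_smooth)
next
  case (insert i I)
  have "has_sa_dim (\<Union>j\<in>I. S j) (Max (d ` I))"
    by (rule insert.IH) (simp_all add: insert.prems)
  moreover have "has_sa_dim (S i) (d i)"
    by (rule has_sa_dim_smooth) (simp_all add: insert.prems)
  moreover have "semialgebraic_in V (S i)"
    by (simp add: insert.prems)
  ultimately have "has_sa_dim (S i \<union> (\<Union>j\<in>I. S j)) (max (d i) (Max (d ` I)))"
    using has_sa_dim_Un[OF \<open>subspace V\<close>] by blast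
  then show ?case using insert.hyps by simp
qed

section \<open>The set \<open>C_k\<close>\<close>

text \<open>The type \<open>'n\<close> indexes the coordinates, so \<open>k\<close> is \<open>CARD('n)\<close>.\<close>

definition G_space :: "((real^'n) \<times> (real^'n^'n)) set" where
  "G_space = {(x, Y). transpose Y = - Y}"

definition C_set :: "((real^'n) \<times> (real^'n^'n)) set" where
  "C_set = {(x, Y). (x, Y) \<in> G_space \<and> Y \<noteq> 0 \<and>
     (\<exists>M. orthogonal_matrix M \<and> M \<noteq> mat 1 \<and> M *v x = x \<and> M ** Y ** transpose M = Y \<and>
          (\<forall>v. Y *v v = 0 \<longrightarrow> M *v v = v))}"

lemma subspace_G_space: "subspace (G_space :: ((real^'n) \<times> (real^'n^'n)) set)"
proof -
  have "transpose 0 = (0 :: real^'n^'n)"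
    and "transpose (A + B) = transpose A + transpose B"
    and "transpose (c *\<^sub>R A) = c *\<^sub>R transpose A" for A B :: "real^'n^'n" and c
    by (simp_all add: transpose_def vec_eq_iff)
  then show ?thesis
    by (auto simp: subspace_def G_space_def zero_prod_def)
qed

end

(* A pair (x, Y) lies in C_k iff some Y-invariant subspace orthogonal to x is not contained in ker Y:
   given M take the range of 1 - M, and conversely such a subspace contains a plane spanned by u and Y u with
   Y^2 u = - c u, c > 0, and the map that is -1 on this plane and 1 on its complement can serve as M.

   Semi-algebraicity: the largest candidate subspace is cut out by the Krylov vectors Y^j x, so membership
   says that the span of the Y^j x with 1 <= j <= k has smaller dimension than the range of Y.  Ranks are
   compared through Gram determinants.

   Codimension: an invariant plane is the image of a coordinate plane under A = 1 + N, with N skew-symmetric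
   and off-diagonal in the block decomposition.  Then A also carries the complementary coordinate subspace to
   the orthogonal complement, so (x, Y) = (A r, A D A^T) with D block diagonal and r vanishing on the plane.
   Letting N and D be the blocks of a single skew-symmetric matrix Z, this covers C_k by finitely many
   polynomial images of linear subspaces of codimension 2 of the space of pairs (r, Z), whence the upper bound;
   near r = 0, Z = the generator of rotations of the plane, the parametrisation is a local diffeomorphism. *)

theory Submission
  imports Defs
begin


section \<open>Smooth maps\<close>

text \<open>A derivative depends only on values near the point, so openness of \<open>U\<close> lets
  agreement on \<open>U\<close> pass to derivatives of every order.\<close>

lemma Cn_on_cong:
  assumes "open U" "\<And>x. x \<in> U \<Longrightarrow> f x = g x" "Cn_on n f U"
  shows "Cn_on n g U"
  using assms(2,3)
proof (induction n arbitrary: f g)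
  case 0
  then show ?case by (simp cong: continuous_on_cong)
next
  case (Suc n)
  have deriv: "(g has_derivative frechet_derivative f (at x)) (at x)" if "x \<in> U" for x
  proof (rule has_derivative_transform_within_open[OF _ assms(1) that])
    show "(f has_derivative frechet_derivative f (at x)) (at x)"
      using Suc.prems(2) that by (simp add: frechet_derivative_works)
  qed (use Suc.prems(1) in auto)
  have eq: "frechet_derivative f (at x) v = frechet_derivative g (at x) v" if "x \<in> U" for x v
    using frechet_derivative_at[OF deriv[OF that]] by simp
  show ?case
    unfolding Cn_on.simps
  proof (intro conjI ballI allI)
    show "g differentiable at x" if "x \<in> U" for x
      using deriv[OF that] by (auto simp: differentiable_def)
    show "Cn_on n (\<lambda>x. frechet_derivative g (at x) v) U" for v
      using Suc.prems(2) by (intro Suc.IH[OF eq]) auto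
  qed
qed

text \<open>Lets any explicit derivative stand in for the choice-based
  \<open>frechet_derivative\<close>.\<close>

lemma Cn_on_SucI:
  assumes "open U" "\<And>x. x \<in> U \<Longrightarrow> (f has_derivative f' x) (at x)" "\<And>v. Cn_on n (\<lambda>x. f' x v) U"
  shows "Cn_on (Suc n) f U"
  unfolding Cn_on.simps
proof (intro conjI ballI allI)
  show "f differentiable at x" if "x \<in> U" for x
    using assms(2)[OF that] by (auto simp: differentiable_def)
  show "Cn_on n (\<lambda>x. frechet_derivative f (at x) v) U" for v
    by (rule Cn_on_cong[OF assms(1) _ assms(3)]) (simp add: frechet_derivative_at[OF assms(2), symmetric])
qed

lemma Cn_on_SucD:
  assumes "Cn_on (Suc n) f U"
  shows "Cn_on n f U"
  using assms
proof (induction n arbitrary: f)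
  case 0
  then show ?case
    by (auto intro!: continuous_at_imp_continuous_on differentiable_imp_continuous_within)
qed simp

lemma Cn_on_Suc_has_derivative:
  "Cn_on (Suc n) f U \<Longrightarrow> x \<in> U \<Longrightarrow> (f has_derivative frechet_derivative f (at x)) (at x)"
  by (simp add: frechet_derivative_works)

lemma Cn_on_const: "Cn_on n (\<lambda>x. c) U"
  by (induction n arbitrary: c) auto

lemma Cn_on_add:
  assumes "open U" "Cn_on n f U" "Cn_on n g U"
  shows "Cn_on n (\<lambda>x. f x + g x) U"
  using assms(2,3)
proof (induction n arbitrary: f g)
  case 0
  then show ?case by (simp add: continuous_on_add)
next
  case (Suc n)
  show ?case
  proof (rule Cn_on_SucI[OF assms(1)])
    show "((\<lambda>x. f x + g x) has_derivative (\<lambda>v. frechet_derivative f (at x) v + frechet_derivative g (at x) v)) (at x)"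
      if "x \<in> U" for x
      using Suc.prems that by (intro has_derivative_add Cn_on_Suc_has_derivative)
  qed (use Suc in simp)
qed

lemma Cn_on_sum:
  assumes "open U" "\<And>i. i \<in> I \<Longrightarrow> Cn_on n (f i) U"
  shows "Cn_on n (\<lambda>x. \<Sum>i\<in>I. f i x) U"
  using assms(2) by (induction I rule: infinite_finite_induct) (auto intro: Cn_on_const Cn_on_add[OF assms(1)])

lemma Cn_on_bounded_linear:
  assumes "open U" "bounded_linear L" "Cn_on n f U"
  shows "Cn_on n (\<lambda>x. L (f x)) U"
  using assms(3)
proof (induction n arbitrary: f)
  case 0
  then show ?case by (simp add: bounded_linear.continuous_on[OF assms(2)])
next
  case (Suc n)
  show ?case
  proof (rule Cn_on_SucI[OF assms(1)])
    show "((\<lambda>x. L (f x)) has_derivative (\<lambda>v. L (frechet_derivative f (at x) v))) (at x)"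
      if "x \<in> U" for x
      using Suc.prems that by (intro bounded_linear.has_derivative[OF assms(2)] Cn_on_Suc_has_derivative)
  qed (use Suc in simp)
qed

lemma Cn_on_bounded_bilinear:
  assumes "open U" "bounded_bilinear P" "Cn_on n f U" "Cn_on n g U"
  shows "Cn_on n (\<lambda>x. P (f x) (g x)) U"
  using assms(3,4)
proof (induction n arbitrary: f g)
  case 0
  then show ?case by (simp add: bounded_bilinear.continuous_on[OF assms(2)])
next
  case (Suc n)
  show ?case
  proof (rule Cn_on_SucI[OF assms(1)])
    show "((\<lambda>x. P (f x) (g x)) has_derivative
        (\<lambda>v. P (f x) (frechet_derivative g (at x) v) + P (frechet_derivative f (at x) v) (g x))) (at x)"
      if "x \<in> U" for x
      using Suc.prems that by (intro bounded_bilinear.FDERIV[OF assms(2)] Cn_on_Suc_has_derivative)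
  \<comment> \<open>Each term of the product rule pairs a derivative of order n with an
    undifferentiated factor, whose order \<open>Cn_on_SucD\<close> lowers to n.\<close>
  qed (use Suc in \<open>auto intro!: Cn_on_add[OF assms(1)] Suc.IH intro: Cn_on_SucD\<close>)
qed

lemma Cn_on_Pair:
  assumes "open U" "Cn_on n f U" "Cn_on n g U"
  shows "Cn_on n (\<lambda>x. (f x, g x)) U"
proof -
  have "Cn_on n (\<lambda>x. (f x, 0) + (0, g x)) U"
    by (intro Cn_on_add assms Cn_on_bounded_linear[OF assms(1), where L = "\<lambda>y. (y, 0)"]
        Cn_on_bounded_linear[OF assms(1), where L = "\<lambda>y. (0, y)"]) (auto intro!: bounded_linear_intros)
  then show ?thesis by simp
qed

lemma Cn_on_real_polynomial:
  assumes "real_polynomial_function p" "open U" "Cn_on n f U"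
  shows "Cn_on n (\<lambda>x. p (f x)) U"
  using assms(1)
  by induction (auto intro: Cn_on_const Cn_on_bounded_linear Cn_on_add
      Cn_on_bounded_bilinear[OF _ bounded_bilinear_mult] assms(2,3))

lemma Cn_on_polynomial:
  fixes p :: "'b::euclidean_space \<Rightarrow> 'c::euclidean_space"
  assumes "polynomial_function p" "open U" "Cn_on n f U"
  shows "Cn_on n (\<lambda>x. p (f x)) U"
proof -
  have "Cn_on n (\<lambda>x. \<Sum>b\<in>Basis. (p (f x) \<bullet> b) *\<^sub>R b) U"
    using assms(1) unfolding polynomial_function_iff_Basis_inner
    by (intro Cn_on_sum Cn_on_bounded_linear[OF assms(2) bounded_linear_scaleR_left]
        Cn_on_real_polynomial[OF _ assms(2,3)] assms(2)) auto
  then show ?thesis by (simp add: euclidean_representation)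
qed

lemma Cn_on_id: "open U \<Longrightarrow> Cn_on n (\<lambda>x. x) U"
proof (induction n)
  case (Suc n)
  then show ?case by (intro Cn_on_SucI[where f' = "\<lambda>_ v. v"] Cn_on_const) (auto intro: derivative_intros)
qed (simp add: continuous_on_id)

lemma smooth_on_polynomial:
  "polynomial_function p \<Longrightarrow> open U \<Longrightarrow> smooth_on U p"
  unfolding smooth_on_def using Cn_on_polynomial[OF _ _ Cn_on_id] by blast

section \<open>Derivatives and local inverses of polynomial maps\<close>

text \<open>The derivative is polynomial jointly in base point and direction, so the tangent map of
  a polynomial map is again polynomial and can be differentiated further.\<close>

lemma real_polynomial_function_has_derivative:
  assumes "real_polynomial_function p"
  obtains p' where "\<And>x. (p has_derivative p' x) (at x)"
    "real_polynomial_function (\<lambda>z. p' (fst z) (snd z))"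
proof -
  have "\<exists>p'. (\<forall>x. (p has_derivative p' x) (at x)) \<and> real_polynomial_function (\<lambda>z. p' (fst z) (snd z))"
    using assms
  proof induction
    case (linear f)
    then show ?case
      by (intro exI[of _ "\<lambda>_. f"])
        (auto intro: bounded_linear_imp_has_derivative real_polynomial_function.intros(1) bounded_linear_compose bounded_linear_snd)
  next
    case (const c)
    then show ?case
      by (intro exI[of _ "\<lambda>_ _. 0"]) (auto intro: real_polynomial_function.intros(2))
  next
    case (add f g)
    then obtain f' g' where "\<And>x. (f has_derivative f' x) (at x)" "real_polynomial_function (\<lambda>z. f' (fst z) (snd z))"
      "\<And>x. (g has_derivative g' x) (at x)" "real_polynomial_function (\<lambda>z. g' (fst z) (snd z))"
      by blast
    then show ?case
      by (intro exI[of _ "\<lambda>x v. f' x v + g' x v"])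
        (auto intro: real_polynomial_function.intros(3) has_derivative_add)
  next
    case (mult f g)
    then obtain f' g' where "\<And>x. (f has_derivative f' x) (at x)" "real_polynomial_function (\<lambda>z. f' (fst z) (snd z))"
      "\<And>x. (g has_derivative g' x) (at x)" "real_polynomial_function (\<lambda>z. g' (fst z) (snd z))"
      by blast
    moreover have "real_polynomial_function (\<lambda>z. f (fst z))" "real_polynomial_function (\<lambda>z. g (fst z))"
      using mult.hyps real_polynomial_function_compose[OF polynomial_function_bounded_linear[OF bounded_linear_fst]]
      unfolding o_def by auto
    ultimately show ?case
      by (intro exI[of _ "\<lambda>x v. f x * g' x v + f' x v * g x"])
        (auto intro: real_polynomial_function.intros(3) real_polynomial_function.intros(4) has_derivative_mult)
  qed
  then show thesis using that by blast
qed

lemma polynomial_function_has_derivative: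
  fixes p :: "'a::euclidean_space \<Rightarrow> 'b::euclidean_space"
  assumes "polynomial_function p"
  obtains p' where "\<And>x. (p has_derivative p' x) (at x)"
    "polynomial_function (\<lambda>z. p' (fst z) (snd z))"
proof -
  have "\<exists>q. (\<forall>x. ((\<lambda>x. p x \<bullet> b) has_derivative q x) (at x)) \<and> real_polynomial_function (\<lambda>z. q (fst z) (snd z))"
    if "b \<in> Basis" for b
    using that assms real_polynomial_function_has_derivative unfolding polynomial_function_iff_Basis_inner by metis
  then obtain q where q: "\<And>b x. b \<in> Basis \<Longrightarrow> ((\<lambda>x. p x \<bullet> b) has_derivative q b x) (at x)"
    "\<And>b. b \<in> Basis \<Longrightarrow> real_polynomial_function (\<lambda>z. q b (fst z) (snd z))"
    by metis
  show thesis
  proof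
    have "((\<lambda>x. \<Sum>b\<in>Basis. (p x \<bullet> b) *\<^sub>R b) has_derivative (\<lambda>v. \<Sum>b\<in>Basis. q b x v *\<^sub>R b)) (at x)" for x
      by (intro has_derivative_sum has_derivative_scaleR_left q)
    then show "(p has_derivative (\<lambda>v. \<Sum>b\<in>Basis. q b x v *\<^sub>R b)) (at x)" for x
      by (simp add: euclidean_representation)
    show "polynomial_function (\<lambda>z. \<Sum>b\<in>Basis. q b (fst z) (snd z) *\<^sub>R b)"
      using q(2) by (intro polynomial_function_sum polynomial_function_mult)
        (auto simp: real_polynomial_function_eq)
  qed
qed


text \<open>Differentiability of \<open>y \<mapsto> B y w\<close>, the derivative of the inverse, comes for free from the inverse
  function rule applied to the tangent map \<open>(x, v) \<mapsto> (g x, g' x v)\<close>, whose inverse is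
  \<open>(y, w) \<mapsto> (h y, B y w)\<close>.  The resulting formula is polynomial in \<open>h\<close> and \<open>B\<close>, which drives
  the induction over the order of differentiability.\<close>

lemma smooth_on_polynomial_inverse:
  fixes g h :: "'a::euclidean_space \<Rightarrow> 'a"
  assumes g': "\<And>x. (g has_derivative g' x) (at x)" and p': "polynomial_function (\<lambda>z. g' (fst z) (snd z))"
    and U: "open U" and V: "open V" and hU: "\<And>y. y \<in> V \<Longrightarrow> h y \<in> U"
    and hg: "\<And>x. x \<in> U \<Longrightarrow> h (g x) = x" and gh: "\<And>y. y \<in> V \<Longrightarrow> g (h y) = y"
    and Bg: "\<And>x v. x \<in> U \<Longrightarrow> B (g x) (g' x v) = v"
  shows "smooth_on V h"
proof -
  obtain G where G: "\<And>z. ((\<lambda>z. g' (fst z) (snd z)) has_derivative G z) (at z)"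
    "polynomial_function (\<lambda>z. G (fst z) (snd z))"
    using polynomial_function_has_derivative[OF p'] by metis
  have lin: "linear (g' x)" for x
    using g' has_derivative_linear by blast
  have inj: "inj (g' x)" if "x \<in> U" for x
    using Bg[OF that] by (intro inj_on_inverseI)
  have gB: "g' x (B (g x) v) = v" if "x \<in> U" for x v
  proof -
    have "surj (g' x)" using lin inj[OF that] by (rule linear_inj_imp_surj)
    then obtain u where "v = g' x u" by (metis surjD)
    then show ?thesis using Bg[OF that] by simp
  qed
  have linB: "linear (B (g x))" if "x \<in> U" for x
  proof (rule linearI)
    show "B (g x) (a + b) = B (g x) a + B (g x) b" for a b
      using Bg[OF that, of "B (g x) a + B (g x) b"] by (simp add: linear_add[OF lin] gB[OF that])
    show "B (g x) (c *\<^sub>R a) = c *\<^sub>R B (g x) a" for c a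
      using Bg[OF that, of "c *\<^sub>R B (g x) a"] by (simp add: linear_cmul[OF lin] gB[OF that])
  qed
  have h': "(h has_derivative B y) (at y)" if "y \<in> V" for y
  proof -
    have "(h has_derivative B y) (at (g (h y)))"
    proof (rule has_derivative_inverse_strong[OF U hU[OF that] _ hg g'])
      show "continuous_on U g"
        using g' by (meson continuous_at_imp_continuous_on has_derivative_continuous)
      show "g' (h y) \<circ> B y = id"
        using gB[OF hU[OF that]] gh[OF that] by (auto simp: fun_eq_iff)
    qed
    then show ?thesis using gh[OF that] by simp
  qed
  have B': "((\<lambda>y. B y w) has_derivative (\<lambda>a. - B y (G (h y, B y w) (B y a, 0)))) (at y)"
    if y: "y \<in> V" for y w
  proof -
    define x v where "x = h y" and "v = B y w"
    have x: "x \<in> U" and gx: "g x = y" and gv: "g' x v = w"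
      using hU[OF y] gh[OF y] gB[of x w] unfolding x_def v_def by auto
    have contg: "continuous_on UNIV g"
      using g' by (meson continuous_at_imp_continuous_on has_derivative_continuous)
    define T where "T = (\<lambda>z. (g (fst z), g' (fst z) (snd z)))"
    define T' where "T' = (\<lambda>c. (g' x (fst c), G (x, v) c))"
    define R where "R = (\<lambda>z. (h (fst z), B (fst z) (snd z)))"
    \<comment> \<open>\<open>T'\<close> is block triangular with \<open>g' x\<close> in both
      diagonal blocks; this is its inverse, found by back substitution.\<close>
    define R' where "R' = (\<lambda>c. (B y (fst c), B y (snd c - G (x, v) (B y (fst c), 0))))"
    have linG: "linear (G (x, v))" using G(1) has_derivative_linear by blast
    have "((\<lambda>z. g (fst z)) has_derivative (\<lambda>c. g' x (fst c))) (at (x, v))"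
      using has_derivative_compose[of fst fst "(x, v)" UNIV g "g' x"] g' has_derivative_fst[OF has_derivative_ident]
      by auto
    from has_derivative_Pair[OF this G(1)] have T: "(T has_derivative T') (at (x, v))"
      unfolding T_def T'_def .
    \<comment> \<open>The differentiated map is linear in its second argument, so its partial
      derivative there is the map itself.\<close>
    have Gsnd: "G (x, v) (0, u) = g' x u" for u
    proof -
      have "((\<lambda>u. (x, u)) has_derivative (\<lambda>u. (0, u))) (at v)"
        by (auto intro!: derivative_eq_intros)
      from has_derivative_compose[OF this G(1)]
      have "((\<lambda>u. g' x u) has_derivative (\<lambda>u. G (x, v) (0, u))) (at v)" by simp
      moreover have "((\<lambda>u. g' x u) has_derivative g' x) (at v)"
        using lin by (simp add: linear_imp_has_derivative)
      ultimately show ?thesis by (metis has_derivative_unique)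
    qed
    have "(R has_derivative R') (at (T (x, v)))"
    proof (rule has_derivative_inverse_strong[OF open_Times[OF U open_UNIV] _ _ _ T])
      show "(x, v) \<in> U \<times> UNIV" using x by simp
      show "continuous_on (U \<times> UNIV) T" unfolding T_def
      proof (intro continuous_on_Pair)
        show "continuous_on (U \<times> UNIV) (\<lambda>z. g (fst z))"
          using continuous_on_compose2[OF contg continuous_on_fst[OF continuous_on_id]] by blast
        show "continuous_on (U \<times> UNIV) (\<lambda>z. g' (fst z) (snd z))"
          using G(1) by (meson continuous_at_imp_continuous_on has_derivative_continuous)
      qed
      show "R (T z) = z" if "z \<in> U \<times> UNIV" for z
        using that hg Bg unfolding R_def T_def by auto
      have "G (x, v) (a, b) = G (x, v) (a, 0) + g' x b" for a b
        using linear_add[OF linG, of "(a, 0)" "(0, b)"] Gsnd by simp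
      then have "T' (R' (a, b)) = (a, b)" for a b
        using gB[OF x] unfolding T'_def R'_def gx by (metis diff_add_cancel add.commute fst_conv snd_conv)
      then show "T' \<circ> R' = id"
        by (auto simp: fun_eq_iff)
    qed
    then have R: "(R has_derivative R') (at (y, w))" unfolding T_def using gx gv by simp
    \<comment> \<open>Restricting \<open>R\<close> to the slice of constant \<open>w\<close> and
      taking the second component isolates the dependence of \<open>B y w\<close> on
      \<open>y\<close>.\<close>
    have "((\<lambda>y. (y, w)) has_derivative (\<lambda>a. (a, 0))) (at y)"
      by (auto intro!: derivative_eq_intros)
    from has_derivative_snd[OF has_derivative_compose[OF this R]]
    have "((\<lambda>y. B y w) has_derivative (\<lambda>a. B y (0 - G (x, v) (B y a, 0)))) (at y)"
      unfolding R_def R'_def by simp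
    then show ?thesis
      using linear_diff[OF linB[OF x], of 0] linear_0[OF linB[OF x]] unfolding x_def v_def gh[OF y] by simp
  qed
  have "Cn_on n h V \<and> (\<forall>w. Cn_on n (\<lambda>y. B y w) V)" for n
  proof (induction n)
    case 0
    show ?case
      using h' B' by (auto intro!: continuous_at_imp_continuous_on has_derivative_continuous)
  next
    case (Suc n)
    have "Cn_on (Suc n) h V"
      by (rule Cn_on_SucI[OF V h']) (use Suc in auto)
    moreover have "Cn_on (Suc n) (\<lambda>y. B y w) V" for w
    proof (rule Cn_on_SucI[OF V B'])
      fix a
      \<comment> \<open>The argument of the outer \<open>B y\<close> itself varies with
        \<open>y\<close>. Expanding it in the basis leaves products of scalar functions with
        \<open>B y b\<close> for fixed \<open>b\<close>, to which the induction hypothesis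
        applies.\<close>
      define q where "q = (\<lambda>y. G (h y, B y w) (B y a, 0))"
      have "Cn_on n (\<lambda>y. ((h y, B y w), (B y a, 0 :: 'a))) V"
        by (rule Cn_on_Pair[OF V Cn_on_Pair[OF V] Cn_on_Pair[OF V _ Cn_on_const]]) (use Suc in auto)
      from Cn_on_polynomial[OF G(2) V this] have "Cn_on n q V"
        unfolding q_def by simp
      then have "Cn_on n (\<lambda>y. q y \<bullet> b) V" for b
        by (rule Cn_on_bounded_linear[OF V bounded_linear_inner_left])
      then have "Cn_on n (\<lambda>y. \<Sum>b\<in>Basis. (q y \<bullet> b) *\<^sub>R B y b) V"
        using Suc by (intro Cn_on_sum[OF V] Cn_on_bounded_bilinear[OF V bounded_bilinear_scaleR]) auto
      then have "Cn_on n (\<lambda>y. - (\<Sum>b\<in>Basis. (q y \<bullet> b) *\<^sub>R B y b)) V"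
        by (rule Cn_on_bounded_linear[OF V bounded_linear_minus[OF bounded_linear_ident]])
      then show "Cn_on n (\<lambda>y. - B y (G (h y, B y w) (B y a, 0))) V"
      proof (rule Cn_on_cong[OF V, rotated])
        fix y assume y: "y \<in> V"
        have "linear (B y)" using linB[OF hU[OF y]] gh[OF y] by simp
        then have "B y (\<Sum>b\<in>Basis. (q y \<bullet> b) *\<^sub>R b) = (\<Sum>b\<in>Basis. (q y \<bullet> b) *\<^sub>R B y b)"
          by (simp add: linear_sum linear_cmul)
        then show "- (\<Sum>b\<in>Basis. (q y \<bullet> b) *\<^sub>R B y b) = - B y (G (h y, B y w) (B y a, 0))"
          by (simp add: euclidean_representation q_def)
      qed
    qed
    ultimately show ?case by blast
  qed
  then show ?thesis unfolding smooth_on_def by blast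
qed

text \<open>Domain and target have equal dimension, so injectivity of \<open>D\<close> gives
  invertibility and the inverse function theorem applies. Smoothness of the inverse follows from
  \<open>smooth_on_polynomial_inverse\<close>, where \<open>B y\<close> is the inverse of the
  derivative at \<open>h y\<close>.\<close>

lemma polynomial_local_diffeomorphism:
  fixes g :: "'a::euclidean_space \<Rightarrow> 'a"
  assumes g: "polynomial_function g" and g0: "(g has_derivative D) (at p)" and inj: "\<And>v. D v = 0 \<Longrightarrow> v = 0"
  obtains U V h where "open U" "p \<in> U" "open V" "homeomorphism U V g h" "smooth_on U g" "smooth_on V h"
proof -
  obtain g' where g': "\<And>x. (g has_derivative g' x) (at x)" "polynomial_function (\<lambda>z. g' (fst z) (snd z))"
    using polynomial_function_has_derivative[OF g] by metis
  have bl: "bounded_linear (g' x)" for x using g'(1) has_derivative_bounded_linear by blast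
  have "g' p = D" using g0 g'(1) has_derivative_unique by blast
  then have "inj (g' p)" using inj unfolding linear_injective_0[OF bounded_linear.linear[OF bl]] by blast
  then obtain k where k: "linear k" "k \<circ> g' p = id"
    using linear_injective_left_inverse[of "g' p"] bl bounded_linear.linear by blast
  have blin: "blinfun_apply (Blinfun (g' x)) = g' x" for x by (rule bounded_linear_Blinfun_apply[OF bl])
  have kblin: "blinfun_apply (Blinfun k) = k"
    using k(1) by (intro bounded_linear_Blinfun_apply) (simp add: linear_conv_bounded_linear)
  have cont: "continuous_on UNIV (\<lambda>x. Blinfun (g' x))"
  proof (rule continuous_on_blinfun_componentwise)
    fix i :: 'a assume "i \<in> Basis"
    obtain G where G: "\<And>z. ((\<lambda>z. g' (fst z) (snd z)) has_derivative G z) (at z)"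
      using polynomial_function_has_derivative[OF g'(2)] by metis
    have "((\<lambda>x. (x, i)) has_derivative (\<lambda>a. (a, 0))) (at x)" for x
      by (auto intro!: derivative_eq_intros)
    from has_derivative_compose[OF this G] have "isCont (\<lambda>x. g' x i) x" for x
      using has_derivative_continuous by fastforce
    then show "continuous_on UNIV (\<lambda>x. blinfun_apply (Blinfun (g' x)) i)"
      unfolding blin by (simp add: continuous_at_imp_continuous_on)
  qed
  have "Blinfun k o\<^sub>L Blinfun (g' p) = id_blinfun"
    using k(2) by (intro blinfun_eqI) (simp add: blin kblin pointfree_idE)
  from inverse_function_theorem[where f = g and f' = "\<lambda>x. Blinfun (g' x)" and U = UNIV, OF open_UNIV _ cont UNIV_I this]
  obtain U V h where UV: "open U" "p \<in> U" "open V" "homeomorphism U V g h"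
    and bij: "\<And>y. y \<in> V \<Longrightarrow> bij (g' (h y))"
    unfolding blin using g'(1) by metis
  have hU: "h y \<in> U" "g (h y) = y" if "y \<in> V" for y
    using UV(4) that by (auto simp: homeomorphism_def)
  have gV: "g x \<in> V" "h (g x) = x" if "x \<in> U" for x
    using UV(4) that by (auto simp: homeomorphism_def)
  have "smooth_on V h"
  proof (rule smooth_on_polynomial_inverse[OF g' UV(1,3) hU(1) gV(2) hU(2)])
    show "inv (g' (h (g x))) (g' x v) = v" if "x \<in> U" for x v
      using bij[OF gV(1)[OF that]] gV(2)[OF that] by (simp add: bij_is_inj)
  qed
  with UV smooth_on_polynomial[OF g UV(1)] that show thesis by blast
qed


section \<open>Submanifolds as images of subspaces, and an upper bound for dimensions\<close>

text \<open>The inverse \<open>h\<close> serves as slice chart at every point: it flattens the image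
  onto \<open>Q\<close>.\<close>

lemma smooth_submanifold_image:
  fixes g :: "'a::euclidean_space \<Rightarrow> 'a"
  assumes "open U" "open V" "homeomorphism U V g h" "smooth_on U g" "smooth_on V h" "subspace Q"
  shows "smooth_submanifold (dim Q) (g ` (Q \<inter> U))"
  unfolding smooth_submanifold_def
proof
  fix p assume "p \<in> g ` (Q \<inter> U)"
  moreover have VU: "g ` U = V" "h ` V = U" "\<And>x. x \<in> U \<Longrightarrow> h (g x) = x" "homeomorphism V U h g"
    using assms(3) homeomorphism_sym by (auto simp: homeomorphism_def)
  ultimately have "p \<in> V" by blast
  have "g ` (Q \<inter> U) \<inter> V = g ` (Q \<inter> U)" using VU(1) by blast
  then have "h ` (g ` (Q \<inter> U) \<inter> V) = (\<lambda>x. x) ` (Q \<inter> U)"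
    using VU(3) by (simp add: image_image)
  then have "h ` (g ` (Q \<inter> U) \<inter> V) = U \<inter> Q" by auto
  with assms \<open>p \<in> V\<close> VU(4)
  show "\<exists>U' V' T \<phi> \<psi>. open U' \<and> p \<in> U' \<and> open V' \<and> subspace T \<and> dim T = dim Q \<and>
      homeomorphism U' V' \<phi> \<psi> \<and> smooth_on U' \<phi> \<and> smooth_on V' (\<psi> :: 'a \<Rightarrow> 'a) \<and>
      \<phi> ` (g ` (Q \<inter> U) \<inter> U') = V' \<inter> T"
    by (intro exI[of _ V] exI[of _ U] exI[of _ Q] exI[of _ h] exI[of _ g] conjI) auto
qed

lemma linear_projection_exists:
  fixes T :: "'a::euclidean_space set"
  assumes "subspace T"
  obtains P where "linear P" "\<And>x. P x \<in> T" "\<And>t. t \<in> T \<Longrightarrow> P t = t"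
proof -
  have "linear (\<lambda>x::'a. x)" by (rule linear_ident)
  from linear_exists_left_inverse_on[OF this assms] obtain P
    where "range P \<subseteq> T" "linear P" "\<forall>t\<in>T. P t = t" by auto
  with that show thesis by blast
qed

text \<open>Serves to move parameter spaces into the chart space of a submanifold of larger
  dimension.\<close>

lemma linear_surj_between_subspaces:
  fixes T Q :: "'a::euclidean_space set"
  assumes "subspace T" "subspace Q" "dim Q \<le> dim T"
  obtains T0 L where "subspace T0" "T0 \<subseteq> T" "dim T0 = dim Q" "linear L" "L ` T0 = Q"
proof -
  obtain T0 where T0: "subspace T0" "T0 \<subseteq> T" "dim T0 = dim Q"
    using choose_subspace_of_subspace[of "dim Q" T] assms(1,3) by (metis span_eq_iff)
  from isometries_subspaces[OF T0(1) assms(2) T0(3)] obtain f where "linear f" "f ` T0 = Q" by metis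
  with T0 that show thesis by blast
qed

text \<open>If \<open>e > d\<close>, then composing with a chart maps negligible sets, the preimages under a projection onto the
  chart space of subspaces \<open>T0 i\<close> of dimension \<open>d\<close>, differentiably onto a set containing a nonempty open set.\<close>

lemma smooth_submanifold_dim_le:
  fixes S :: "'a::euclidean_space set" and f :: "'i \<Rightarrow> 'a \<Rightarrow> 'a"
  assumes S: "smooth_submanifold e S" "S \<noteq> {}" and Q: "\<And>i. i \<in> I \<Longrightarrow> subspace (Q i)"
    "\<And>i. i \<in> I \<Longrightarrow> dim (Q i) = d"
    and I: "finite I" and f: "\<And>i x. i \<in> I \<Longrightarrow> f i differentiable (at x)" and sub: "S \<subseteq> (\<Union>i\<in>I. f i ` Q i)"
  shows "e \<le> d"
proof (rule ccontr)
  assume "\<not> e \<le> d"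
  obtain p where p: "p \<in> S" using S(2) by blast
  obtain U V T and \<phi> \<psi> :: "'a \<Rightarrow> 'a"
    where c: "open U" "p \<in> U" "open V" "subspace T" "dim T = e" "homeomorphism U V \<phi> \<psi>"
      "smooth_on U \<phi>" "smooth_on V \<psi>" "\<phi> ` (S \<inter> U) = V \<inter> T"
    using smooth_submanifold_chart[OF S(1) p] by metis
  obtain P where P: "linear P" "\<And>x. P x \<in> T" "\<And>t. t \<in> T \<Longrightarrow> P t = t"
    using linear_projection_exists[OF c(4)] by metis
  have "\<exists>T0 L. subspace T0 \<and> T0 \<subseteq> T \<and> dim T0 = d \<and> linear L \<and> L ` T0 = Q i" if "i \<in> I" for i
    using linear_surj_between_subspaces[OF c(4) Q(1)[OF that]] Q(2)[OF that] c(5) \<open>\<not> e \<le> d\<close>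
    by (metis nat_le_linear)
  then obtain T0 L where T0: "\<And>i. i \<in> I \<Longrightarrow> subspace (T0 i)" "\<And>i. i \<in> I \<Longrightarrow> T0 i \<subseteq> T"
    "\<And>i. i \<in> I \<Longrightarrow> dim (T0 i) = d" and L: "\<And>i. i \<in> I \<Longrightarrow> linear (L i)" "\<And>i. i \<in> I \<Longrightarrow> L i ` T0 i = Q i"
    by metis
  \<comment> \<open>\<open>F i\<close> acts on the \<open>T\<close> component of a point as the
    parametrisation followed by the chart, and leaves the component in the kernel of
    \<open>P\<close> alone. It thus maps the full space to itself, where measure can be
    used.\<close>
  define N where "N i = {z. P z \<in> T0 i \<and> f i (L i (P z)) \<in> U}" for i
  define F where "F i z = P (\<phi> (f i (L i (P z)))) + z - P z" for i z
  have neg: "negligible (F i ` N i)" if i: "i \<in> I" for i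
  proof (rule negligible_differentiable_image_negligible[OF order_refl])
    have "subspace {z. P z \<in> T0 i}"
      using P(1) T0(1)[OF i] linear_subspace_vimage[of P "T0 i"] by (simp add: vimage_def)
    moreover have "{z. P z \<in> T0 i} \<noteq> UNIV"
    proof
      assume "{z. P z \<in> T0 i} = UNIV"
      then have "T \<subseteq> T0 i" using P(3) by (metis UNIV_I mem_Collect_eq subsetI)
      then have "e \<le> d" using dim_subset[of T "T0 i"] c(5) T0(3)[OF i] by simp
      then show False using \<open>\<not> e \<le> d\<close> by simp
    qed
    ultimately have "dim {z. P z \<in> T0 i} < DIM('a)"
      by (metis dim_eq_full dim_subset_UNIV le_neq_implies_less span_eq_iff)
    then show "negligible (N i)"
      by (intro negligible_subset[OF negligible_lowdim]) (auto simp: N_def)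
    have "F i differentiable (at z)" if "z \<in> N i" for z
    proof -
      define k where "k = (\<lambda>z. f i (L i (P z)))"
      have "\<phi> differentiable (at (k z))"
        using c(7) that unfolding smooth_on_def N_def k_def by (auto dest: spec[of _ "Suc 0"])
      moreover have "k differentiable (at z)"
        using differentiable_compose[OF f[OF i] differentiable_compose[OF linear_imp_differentiable[OF L(1)[OF i]]
            linear_imp_differentiable[OF P(1)]]] unfolding k_def by blast
      ultimately have "(\<lambda>z. \<phi> (k z)) differentiable (at z)"
        by (rule differentiable_compose)
      from differentiable_compose[OF linear_imp_differentiable[OF P(1)] this]
      show ?thesis
        unfolding F_def k_def
        by (rule differentiable_diff[OF differentiable_add[OF _ differentiable_ident] linear_imp_differentiable[OF P(1)]])
    qed
    then show "F i differentiable_on N i"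
      unfolding differentiable_on_def by (blast intro: differentiable_at_withinI)
  qed
  have "{z. P z \<in> V} \<subseteq> (\<Union>i\<in>I. F i ` N i)"
  proof
    fix z assume "z \<in> {z. P z \<in> V}"
    then have "P z \<in> \<phi> ` (S \<inter> U)" using c(9) P(2) by blast
    then obtain s where s: "s \<in> S" "s \<in> U" "P z = \<phi> s" by blast
    then obtain i q where i: "i \<in> I" "q \<in> Q i" "s = f i q" using sub by blast
    then obtain t where t: "t \<in> T0 i" "q = L i t" using L(2) by blast
    \<comment> \<open>The preimage of \<open>z\<close> keeps its kernel component and has the
      parameter \<open>t\<close> as its \<open>T\<close> component.\<close>
    define z' where "z' = t + z - P z"
    have "P z' = P t + P z - P (P z)" unfolding z'_def
      using P(1) by (simp add: linear_add linear_diff)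
    also have "\<dots> = t" using P(2,3) t(1) T0(2)[OF i(1)] by auto
    finally have "P z' = t" .
    moreover have "P (\<phi> s) = \<phi> s" using P(2,3) s(3) by metis
    ultimately have "F i z' = z" "z' \<in> N i"
      unfolding F_def N_def using t i s by (simp_all add: z'_def)
    then show "z \<in> (\<Union>i\<in>I. F i ` N i)" using i(1) by blast
  qed
  then have "negligible {z. P z \<in> V}"
    by (rule negligible_subset[OF negligible_Union, rotated 2]) (use I neg in auto)
  moreover have "open {z. P z \<in> V}"
    using c(3) P(1) by (simp add: linear_continuous_on linear_conv_bounded_linear open_vimage[unfolded vimage_def])
  moreover have "\<phi> p \<in> {z. P z \<in> V}"
    using c(9) p c(2) P(3) by fastforce
  ultimately show False using open_not_negligible by blast
qed


section \<open>Skew-symmetric matrices and their invariant planes\<close>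

lemma inner_transpose_mult:
  fixes Y :: "real^'n^'n"
  shows "(transpose Y *v a) \<bullet> b = a \<bullet> (Y *v b)"
  by (metis dot_lmul_matrix transpose_matrix_vector)

lemma matrix_vector_mult_uminus: "(- Y) *v a = - (Y *v a)" for Y :: "real^'n^'m"
  by (simp add: matrix_vector_mult_def vec_eq_iff sum_negf)

lemma skew_inner:
  fixes Y :: "real^'n^'n"
  assumes "transpose Y = - Y"
  shows "(Y *v a) \<bullet> b = - (a \<bullet> (Y *v b))"
  using inner_transpose_mult[of Y a b] unfolding assms matrix_vector_mult_uminus by simp

lemma skew_inner_self:
  fixes Y :: "real^'n^'n"
  assumes "transpose Y = - Y"
  shows "a \<bullet> (Y *v a) = 0"
  using skew_inner[OF assms, of a a] by (simp add: inner_commute)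

text \<open>The square of a skew-symmetric matrix is negative semidefinite, and a unit vector of an invariant
  subspace at which the norm of the image is maximal is an eigenvector of the square.\<close>

lemma skew_invariant_eigenvector:
  fixes Y :: "real^'n^'n"
  assumes Y: "transpose Y = - Y" and E: "subspace E" "\<And>v. v \<in> E \<Longrightarrow> Y *v v \<in> E"
    and v: "v \<in> E" "Y *v v \<noteq> 0"
  obtains u c where "u \<in> E" "norm u = 1" "c > 0" "Y *v (Y *v u) = - c *\<^sub>R u"
proof -
  define S where "S = E \<inter> sphere 0 1"
  have v0: "v \<noteq> 0" using v(2) by auto
  then have vS: "v /\<^sub>R norm v \<in> S" unfolding S_def using v(1) E(1) by (simp add: subspace_scale)
  have "compact S" unfolding S_def by (simp add: closed_Int_compact closed_subspace[OF E(1)])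
  moreover have "continuous_on S (\<lambda>z. norm (Y *v z))"
    by (intro continuous_on_norm linear_continuous_on matrix_vector_mul_bounded_linear)
  ultimately obtain u where u: "u \<in> S" "\<And>z. z \<in> S \<Longrightarrow> norm (Y *v z) \<le> norm (Y *v u)"
    using continuous_attains_sup[of S "\<lambda>z. norm (Y *v z)"] vS by blast
  define m where "m = norm (Y *v u)"
  have le: "norm (Y *v z) \<le> m * norm z" if "z \<in> E" for z
  proof (cases "z = 0")
    case False
    then have "z /\<^sub>R norm z \<in> S" unfolding S_def using that E(1) by (simp add: subspace_scale)
    from u(2)[OF this] have "norm (Y *v z) / norm z \<le> m"
      unfolding m_def by (simp add: matrix_vector_mult_scaleR divide_inverse mult.commute)
    then show ?thesis using False by (simp add: field_simps)
  qed (simp add: m_def)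
  have uE: "u \<in> E" "norm u = 1" using u(1) unfolding S_def by auto
  have "m \<noteq> 0" using le[OF v(1)] v(2) by auto
  then have m: "m > 0" unfolding m_def by simp
  define w where "w = Y *v u"
  have "norm (Y *v w) \<le> m\<^sup>2"
    using le[OF E(2)[OF uE(1)]] unfolding w_def m_def by (simp add: power2_eq_square)
  then have "(Y *v w) \<bullet> (Y *v w) \<le> m\<^sup>2 * m\<^sup>2"
    unfolding power2_norm_eq_inner[symmetric] power2_eq_square[of "m\<^sup>2", symmetric]
    by (rule power_mono) simp
  moreover have "(Y *v w) \<bullet> u = - m\<^sup>2"
    using skew_inner[OF Y, of w u] unfolding w_def m_def by (simp add: power2_norm_eq_inner)
  moreover have "u \<bullet> u = 1" using uE(2) by (simp add: norm_eq_1)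
  moreover have "u \<bullet> (Y *v w) = (Y *v w) \<bullet> u" by (rule inner_commute)
  \<comment> \<open>Equality case of Cauchy-Schwarz: the left side is the squared norm of
    \<open>Y *v w\<close>, at most m^4, minus 2 m^4 plus m^4.\<close>
  ultimately have "(Y *v w + m\<^sup>2 *\<^sub>R u) \<bullet> (Y *v w + m\<^sup>2 *\<^sub>R u) \<le> 0"
    by (simp add: inner_add_left inner_add_right)
  then have "Y *v w + m\<^sup>2 *\<^sub>R u = 0" by (metis inner_ge_zero inner_eq_zero_iff order_antisym)
  then have "Y *v (Y *v u) = - m\<^sup>2 *\<^sub>R u" unfolding w_def by (simp add: eq_neg_iff_add_eq_0)
  with that[OF uE, of "m\<^sup>2"] m show thesis by simp
qed

lemma matrix_mult_eqI: "(\<And>v. A *v v = B *v v) \<Longrightarrow> A = B" for A B :: "real^'n^'m"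
  by (simp add: matrix_eq)

section \<open>Membership in \<open>C_set\<close> and invariant subspaces\<close>

text \<open>The plane spanned by \<open>u\<close> and \<open>Y *v u\<close> is invariant, as is its
  orthogonal complement, so the map that is -1 on the plane and 1 on the complement commutes with
  \<open>Y\<close>.\<close>

lemma eigenvector_imp_C_set:
  fixes Y :: "real^'n^'n"
  assumes Y: "transpose Y = - Y" and u: "norm u = 1" and c: "c > 0" and Yu: "Y *v (Y *v u) = - c *\<^sub>R u"
    and x: "u \<bullet> x = 0" "(Y *v u) \<bullet> x = 0"
  shows "(x, Y) \<in> C_set"
proof -
  define w where "w = Y *v u"
  have uu: "u \<bullet> u = 1" using u by (simp add: norm_eq_1)
  have Yw: "Y *v w = - c *\<^sub>R u" using Yu unfolding w_def .
  have uw: "u \<bullet> w = 0" unfolding w_def by (rule skew_inner_self[OF Y])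
  have "w \<bullet> w = - (u \<bullet> (Y *v w))" using skew_inner[OF Y, of u w] by (simp add: w_def)
  then have ww: "w \<bullet> w = c" by (simp add: Yw uu)
  \<comment> \<open>Subtracts twice the orthogonal projection to the plane; the divisor
    \<open>c\<close> is the squared norm of \<open>w\<close>.\<close>
  define f where "f v = v - (2 * (v \<bullet> u)) *\<^sub>R u - (2 / c * (v \<bullet> w)) *\<^sub>R w" for v
  have lin: "linear f"
    unfolding f_def by (intro linearI) (simp_all add: algebra_simps inner_simps)
  define M where "M = matrix f"
  have M: "M *v v = f v" for v unfolding M_def using lin by (simp add: matrix_works linear_matrix_vector_mul_eq)
  have "f a \<bullet> f b = a \<bullet> b" for a b
  proof -
    have "w \<bullet> u = 0" "u \<bullet> b = b \<bullet> u" "w \<bullet> b = b \<bullet> w"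
      using uw by (simp_all add: inner_commute)
    then show ?thesis
      unfolding f_def using c by (simp add: inner_diff_left inner_diff_right uu ww uw algebra_simps)
  qed
  then have "orthogonal_transformation f"
    using lin unfolding orthogonal_transformation_def by blast
  then have orth: "orthogonal_matrix M"
    unfolding M_def orthogonal_transformation_matrix by blast
  have "f u = u - (1 + 1) *\<^sub>R u" unfolding f_def uu uw by simp
  also have "\<dots> = - u" unfolding scaleR_add_left by simp
  finally have "f u = - u" .
  then have "(M *v u) \<bullet> u = - 1" unfolding M by (simp add: uu)
  then have "M \<noteq> mat 1" using uu by auto
  have fixes_orth: "f v = v" if "v \<bullet> u = 0" "v \<bullet> w = 0" for v
    unfolding f_def using that by simp
  have Mx: "M *v x = x" unfolding M using x by (intro fixes_orth) (simp_all add: w_def inner_commute)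
  have "Y *v f v = f (Y *v v)" for v
  proof -
    have "Y *v f v = Y *v v - (2 * (v \<bullet> u)) *\<^sub>R w + (2 * (v \<bullet> w)) *\<^sub>R u"
      unfolding f_def using c by (simp add: matrix_vector_mult_diff_distrib matrix_vector_mult_scaleR Yw flip: w_def)
    moreover have "(Y *v v) \<bullet> u = - (v \<bullet> w)" "(Y *v v) \<bullet> w = c * (v \<bullet> u)"
      by (simp_all add: skew_inner[OF Y] Yw flip: w_def)
    ultimately show ?thesis unfolding f_def using c by simp
  qed
  then have "M ** Y = Y ** M"
    by (intro matrix_mult_eqI) (simp add: M flip: matrix_vector_mul_assoc)
  then have comm: "M ** Y ** transpose M = Y"
    using orth unfolding orthogonal_matrix_def by (metis matrix_mul_assoc matrix_mul_rid)
  \<comment> \<open>The kernel of a skew-symmetric matrix is orthogonal to its range, which contains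
    both \<open>w\<close> and \<open>Y *v w\<close>, a nonzero multiple of \<open>u\<close>.\<close>
  have "M *v v = v" if "Y *v v = 0" for v
    unfolding M
  proof (rule fixes_orth)
    show "v \<bullet> w = 0" using skew_inner[OF Y, of v u] that unfolding w_def by simp
    have "c * (v \<bullet> u) = 0" using skew_inner[OF Y, of v w] that by (simp add: Yw)
    then show "v \<bullet> u = 0" using c by simp
  qed
  moreover have "Y \<noteq> 0" using Yu c u by auto
  ultimately show ?thesis
    unfolding C_set_def G_space_def using Y orth \<open>M \<noteq> mat 1\<close> Mx comm by blast
qed

text \<open>Trades the orthogonal matrix for a subspace. The range of 1 - M is invariant because M
  commutes with \<open>Y\<close>, and orthogonal to \<open>x\<close> because M is orthogonal and
  fixes \<open>x\<close>.\<close>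

lemma C_set_iff_invariant_subspace:
  "(x, Y) \<in> C_set \<longleftrightarrow> transpose Y = - Y \<and>
    (\<exists>E. subspace E \<and> (\<forall>v\<in>E. Y *v v \<in> E \<and> v \<bullet> x = 0) \<and> (\<exists>v\<in>E. Y *v v \<noteq> 0))"
proof (intro iffI conjI; (elim conjE exE)?)
  assume C: "(x, Y) \<in> C_set"
  then show Y: "transpose Y = - Y" unfolding C_set_def G_space_def by blast
  obtain M where M: "orthogonal_matrix M" "M \<noteq> mat 1" "M *v x = x" "M ** Y ** transpose M = Y"
    "\<And>v. Y *v v = 0 \<Longrightarrow> M *v v = v"
    using C unfolding C_set_def by blast
  have inner: "(M *v a) \<bullet> (M *v b) = a \<bullet> b" for a b
    using M(1) inner_transpose_mult[of M "M *v a" b]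
    by (simp add: orthogonal_matrix_def matrix_vector_mul_assoc)
  have comm: "M *v (Y *v v) = Y *v (M *v v)" for v
    using M(1,4) unfolding orthogonal_matrix_def by (metis matrix_mul_assoc matrix_mul_rid matrix_vector_mul_assoc)
  define E where "E = range (\<lambda>v. v - M *v v)"
  have "linear (\<lambda>v. v - M *v v)"
    by (intro linear_compose_sub linear_ident matrix_vector_mul_linear)
  then have "subspace E" unfolding E_def using linear_subspace_image subspace_UNIV by blast
  moreover have "Y *v e \<in> E \<and> e \<bullet> x = 0" if e: "e \<in> E" for e
  proof -
    obtain v where v: "e = v - M *v v" using e unfolding E_def by blast
    have "Y *v e = Y *v v - M *v (Y *v v)"
      unfolding v by (simp add: comm matrix_vector_mult_diff_distrib)
    moreover have "e \<bullet> x = 0" using inner[of v x] unfolding v by (simp add: M(3) inner_simps)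
    ultimately show ?thesis unfolding E_def by blast
  qed
  moreover have "\<exists>e\<in>E. Y *v e \<noteq> 0"
  proof -
    obtain v where v: "M *v v \<noteq> v" using M(2) by (metis matrix_mult_eqI matrix_vector_mul_lid)
    define e where "e = v - M *v v"
    \<comment> \<open>Otherwise M fixes \<open>e\<close>; but vectors fixed by an orthogonal matrix
      are orthogonal to the range of 1 - M, so \<open>e\<close> would be orthogonal to
      itself.\<close>
    have "Y *v e \<noteq> 0"
    proof
      assume "Y *v e = 0"
      then have "M *v e = e" by (rule M(5))
      then have "e \<bullet> e = 0" using inner[of e v] unfolding e_def by (simp add: inner_simps)
      then show False using v unfolding e_def by simp
    qed
    then show ?thesis unfolding E_def e_def by blast
  qed
  ultimately show "\<exists>E. subspace E \<and> (\<forall>v\<in>E. Y *v v \<in> E \<and> v \<bullet> x = 0) \<and> (\<exists>v\<in>E. Y *v v \<noteq> 0)"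
    by blast
next
  fix E assume Y: "transpose Y = - Y" and E: "subspace E" "\<forall>v\<in>E. Y *v v \<in> E \<and> v \<bullet> x = 0"
    and "\<exists>v\<in>E. Y *v v \<noteq> 0"
  then obtain u c where "u \<in> E" "norm u = 1" "c > 0" "Y *v (Y *v u) = - c *\<^sub>R u"
    using skew_invariant_eigenvector[OF Y E(1)] by metis
  then show "(x, Y) \<in> C_set" using eigenvector_imp_C_set[OF Y] E(2) by blast
qed

lemma C_setE:
  assumes "(x, Y) \<in> C_set"
  obtains u c where "transpose Y = - Y" "norm u = 1" "c > 0" "Y *v (Y *v u) = - c *\<^sub>R u"
    "u \<bullet> x = 0" "(Y *v u) \<bullet> x = 0"
proof -
  obtain E v where Y: "transpose Y = - Y" and E: "subspace E" "\<And>v. v \<in> E \<Longrightarrow> Y *v v \<in> E"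
    "\<And>v. v \<in> E \<Longrightarrow> v \<bullet> x = 0" "v \<in> E" "Y *v v \<noteq> 0"
    using assms unfolding C_set_iff_invariant_subspace by blast
  from skew_invariant_eigenvector[OF Y E(1,2,4,5)] obtain u c
    where u: "u \<in> E" "norm u = 1" "c > 0" "Y *v (Y *v u) = - c *\<^sub>R u" by metis
  with E(2,3) that[OF Y u(2-4)] show thesis by blast
qed


section \<open>Rank conditions are semi-algebraic\<close>

lemma semialgebraic_in_UN:
  assumes "finite I" "\<And>i. i \<in> I \<Longrightarrow> semialgebraic_in V (A i)"
  shows "semialgebraic_in V (\<Union>i\<in>I. A i)"
  using assms
proof (induction rule: finite_induct)
  case empty
  have "semialgebraic_in V {x \<in> V. 1 = (0::real)}"
    by (rule semialgebraic_in.zero) (rule real_polynomial_function.intros(2))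
  then show ?case by simp
qed (auto intro: semialgebraic_in.union)

lemma semialgebraic_in_INT:
  assumes "finite I" "\<And>i. i \<in> I \<Longrightarrow> semialgebraic_in V {x \<in> V. P i x}"
  shows "semialgebraic_in V {x \<in> V. \<forall>i\<in>I. P i x}"
  using assms
proof (induction rule: finite_induct)
  case empty
  have "semialgebraic_in V {x \<in> V. 0 = (0::real)}"
    by (rule semialgebraic_in.zero) (rule real_polynomial_function.intros(2))
  then show ?case by simp
next
  case (insert i I)
  have "{x \<in> V. \<forall>i\<in>insert i I. P i x} = {x \<in> V. P i x} \<inter> {x \<in> V. \<forall>i\<in>I. P i x}" by blast
  with insert show ?case by (auto intro: semialgebraic_in.inter)
qed

text \<open>The generating rules contain no complement, so the condition is written as positivity of
  the square.\<close>

lemma semialgebraic_in_nonzero: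
  assumes "real_polynomial_function f"
  shows "semialgebraic_in V {x \<in> V. f x \<noteq> 0}"
proof -
  have "semialgebraic_in V {x \<in> V. f x * f x > 0}"
    by (intro semialgebraic_in.pos real_polynomial_function.intros(4) assms)
  moreover have "f x * f x > 0 \<longleftrightarrow> f x \<noteq> 0" for x by (simp add: zero_less_mult_iff) linarith
  ultimately show ?thesis by simp
qed

section \<open>Rank inequalities through Gram determinants\<close>

text \<open>The Gram matrix of the rows with index in \<open>I\<close>, padded by an identity block to keep the index type.\<close>

definition row_gram :: "'n set \<Rightarrow> real^'n^'n \<Rightarrow> real^'n^'n" where
  "row_gram I M = (\<chi> i j. if i \<in> I \<and> j \<in> I then row i M \<bullet> row j M else if i = j then 1 else 0)"

lemma transpose_mult_rows: "transpose M *v c = (\<Sum>i\<in>UNIV. c $ i *\<^sub>R row i M)" for M :: "real^'n^'m"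
  by (simp add: vec_eq_iff matrix_vector_mult_def transpose_def row_def mult.commute)

lemma row_gram_mult:
  assumes "\<And>i. i \<notin> I \<Longrightarrow> c $ i = 0"
  shows "(row_gram I M *v c) $ i = (if i \<in> I then row i M \<bullet> (transpose M *v c) else 0)"
proof -
  have "(row_gram I M *v c) $ i = (\<Sum>j\<in>UNIV. if i \<in> I then c $ j * (row i M \<bullet> row j M) else 0)"
    unfolding matrix_vector_mult_def row_gram_def using assms by (auto intro!: sum.cong)
  then show ?thesis unfolding transpose_mult_rows by (simp add: inner_sum_right)
qed

text \<open>A Gram determinant vanishes exactly when its vectors are dependent. Here
  \<open>transpose M *v c\<close> is the combination of the rows with coefficients \<open>c\<close>,
  and the padding forces kernel vectors to vanish outside \<open>I\<close>.\<close>

lemma det_row_gram_nonzero_iff: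
  "det (row_gram I M) \<noteq> 0 \<longleftrightarrow> (\<forall>c. (\<forall>i. i \<notin> I \<longrightarrow> c $ i = 0) \<longrightarrow> transpose M *v c = 0 \<longrightarrow> c = 0)"
proof -
  have "det (row_gram I M) \<noteq> 0 \<longleftrightarrow> (\<forall>c. row_gram I M *v c = 0 \<longrightarrow> c = 0)"
    unfolding invertible_det_nz[symmetric] invertible_left_inverse matrix_left_invertible_ker ..
  moreover have "row_gram I M *v c = 0 \<longleftrightarrow> (\<forall>i. i \<notin> I \<longrightarrow> c $ i = 0) \<and> transpose M *v c = 0" for c
  proof
    assume c: "row_gram I M *v c = 0"
    have off: "c $ i = 0" if "i \<notin> I" for i
    proof -
      have "(row_gram I M *v c) $ i = (\<Sum>j\<in>UNIV. if i = j then c $ j else 0)"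
        unfolding matrix_vector_mult_def row_gram_def vec_lambda_beta using that by (intro sum.cong) auto
      then show ?thesis using c by simp
    qed
    \<comment> \<open>Summed over all indices, this pairs \<open>c\<close> with its image under the
      Gram matrix, which is the squared norm of \<open>transpose M *v c\<close>.\<close>
    have "c $ i * (row i M \<bullet> (transpose M *v c)) = 0" for i
      using row_gram_mult[where I = I and c = c and M = M and i = i, OF off] c off[of i] by (cases "i \<in> I") auto
    moreover have "(transpose M *v c) \<bullet> a = (\<Sum>i\<in>UNIV. c $ i * (row i M \<bullet> a))" for a
      unfolding transpose_mult_rows by (simp add: inner_sum_left)
    ultimately have "(transpose M *v c) \<bullet> (transpose M *v c) = 0" by (simp only: sum.neutral_const)
    with off show "(\<forall>i. i \<notin> I \<longrightarrow> c $ i = 0) \<and> transpose M *v c = 0" by simp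
  next
    assume c: "(\<forall>i. i \<notin> I \<longrightarrow> c $ i = 0) \<and> transpose M *v c = 0"
    then have "(row_gram I M *v c) $ i = 0" for i
      using row_gram_mult[of I c M i] by (simp only: c) simp
    then show "row_gram I M *v c = 0" by (simp add: vec_eq_iff)
  qed
  ultimately show ?thesis by auto
qed

lemma rank_ge_iff_row_gram:
  fixes M :: "real^'n^'n"
  shows "r \<le> rank M \<longleftrightarrow> (\<exists>I. card I = r \<and> det (row_gram I M) \<noteq> 0)"
proof
  assume "r \<le> rank M"
  obtain B where B: "B \<subseteq> rows M" "independent B" "card B = dim (rows M)"
    using basis_exists by metis
  then obtain C where C: "C \<subseteq> B" "card C = r"
    using \<open>r \<le> rank M\<close> obtain_subset_with_card_n[of r B] by (metis row_rank_def)
  have iC: "independent C" using C(1) B(2) independent_mono by blast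
  have "C \<subseteq> (\<lambda>i. row i M) ` UNIV" using C(1) B(1) by (auto simp: rows_def)
  \<comment> \<open>The set of rows forgets repetitions; \<open>I\<close> selects one index for each
    basis row.\<close>
  then obtain I where I: "inj_on (\<lambda>i. row i M) I" "C = (\<lambda>i. row i M) ` I"
    unfolding subset_image_inj by blast
  have "c = 0" if off: "\<And>i. i \<notin> I \<Longrightarrow> c $ i = 0" and c: "transpose M *v c = 0" for c
  proof -
    define g where "g = inv_into I (\<lambda>i. row i M)"
    have "0 = (\<Sum>i\<in>UNIV. c $ i *\<^sub>R row i M)" using c transpose_mult_rows by metis
    also have "\<dots> = (\<Sum>i\<in>I. c $ i *\<^sub>R row i M)" using off by (intro sum.mono_neutral_right) auto
    also have "\<dots> = (\<Sum>b\<in>C. c $ g b *\<^sub>R b)"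
      unfolding I(2) sum.reindex[OF I(1)] using inv_into_f_f[OF I(1)] by (simp add: g_def)
    finally have "(\<Sum>b\<in>C. c $ g b *\<^sub>R b) = 0" by simp
    then have "c $ g b = 0" if "b \<in> C" for b
      using independentD[OF iC finite_imageI[OF finite[of I], of "\<lambda>i. row i M", folded I(2)] order_refl _ that, of "\<lambda>b. c $ g b"] by blast
    then have "c $ i = 0" if "i \<in> I" for i
      using that I by (metis g_def image_eqI inv_into_f_f)
    then show "c = 0" using off by (auto simp: vec_eq_iff)
  qed
  then have "det (row_gram I M) \<noteq> 0" unfolding det_row_gram_nonzero_iff by blast
  moreover have "card I = r" using I C(2) by (simp add: card_image)
  ultimately show "\<exists>I. card I = r \<and> det (row_gram I M) \<noteq> 0" by blast
next
  assume "\<exists>I. card I = r \<and> det (row_gram I M) \<noteq> 0"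
  then obtain I where I: "card I = r" "det (row_gram I M) \<noteq> 0" by blast
  define D where "D = {c::real^'n. \<forall>i. i \<notin> I \<longrightarrow> c $ i = 0}"
  have D: "subspace D" "dim D = r"
    unfolding D_def using dim_substandard_cart[where d = I and 'a = real] I(1)
    by (simp_all add: subspace_def dim_vec_eq)
  \<comment> \<open>The range of the transpose then has dimension at least that of
    \<open>D\<close>.\<close>
  have "inj_on ((*v) (transpose M)) D"
  proof (rule inj_onI)
    fix a b assume "a \<in> D" "b \<in> D" "transpose M *v a = transpose M *v b"
    then have "a - b \<in> D" "transpose M *v (a - b) = 0"
      unfolding D_def by (simp_all add: matrix_vector_mult_diff_distrib)
    then show "a = b" using I(2)[unfolded det_row_gram_nonzero_iff] unfolding D_def by force
  qed
  then have "dim ((*v) (transpose M) ` D) = dim D"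
    by (intro dim_image_eq) (simp_all add: span_eq_iff[THEN iffD2, OF D(1)])
  moreover have "dim ((*v) (transpose M) ` D) \<le> dim (range ((*v) (transpose M)))"
    by (intro dim_subset) blast
  ultimately show "r \<le> rank M" using D(2) rank_dim_range[of "transpose M"] by (simp add: rank_transpose)
qed

text \<open>The cardinality of \<open>I\<close> is a threshold that \<open>rank B\<close> reaches
  and \<open>rank A\<close> does not. Only finitely many index sets occur, so the condition is a
  finite combination of polynomial ones.\<close>

lemma rank_less_iff_row_gram:
  fixes A B :: "real^'n^'n"
  shows "rank A < rank B \<longleftrightarrow>
    (\<exists>I. det (row_gram I B) \<noteq> 0 \<and> (\<forall>J\<in>{J. card J = card I}. det (row_gram J A) = 0))"
proof
  assume "rank A < rank B"
  then show "\<exists>I. det (row_gram I B) \<noteq> 0 \<and> (\<forall>J\<in>{J. card J = card I}. det (row_gram J A) = 0)"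
    using rank_ge_iff_row_gram[of "rank B" B] rank_ge_iff_row_gram[of "rank B" A] by fastforce
next
  assume "\<exists>I. det (row_gram I B) \<noteq> 0 \<and> (\<forall>J\<in>{J. card J = card I}. det (row_gram J A) = 0)"
  then obtain I where I: "det (row_gram I B) \<noteq> 0" "\<And>J. card J = card I \<Longrightarrow> det (row_gram J A) = 0"
    by auto
  have "card I \<le> rank B" using I(1) rank_ge_iff_row_gram by blast
  moreover have "\<not> card I \<le> rank A" using I(2) rank_ge_iff_row_gram by blast
  ultimately show "rank A < rank B" by linarith
qed

lemma real_polynomial_function_det:
  assumes "\<And>i j. real_polynomial_function (\<lambda>x. F x $ i $ j)"
  shows "real_polynomial_function (\<lambda>x. det (F x :: real^'n^'n))"
  unfolding det_def
  by (intro real_polynomial_function_sum real_polynomial_function.intros(4) real_polynomial_function_prod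
      real_polynomial_function.intros(2) assms finite_permutations) auto

lemma real_polynomial_function_det_row_gram:
  assumes "\<And>i j. real_polynomial_function (\<lambda>x. F x $ i $ j)"
  shows "real_polynomial_function (\<lambda>x. det (row_gram I (F x)))"
proof (rule real_polynomial_function_det)
  fix i j
  show "real_polynomial_function (\<lambda>x. row_gram I (F x) $ i $ j)"
  proof (cases "i \<in> I \<and> j \<in> I")
    case True
    have "real_polynomial_function (\<lambda>x. \<Sum>k\<in>UNIV. F x $ i $ k * F x $ j $ k)"
      by (intro real_polynomial_function_sum real_polynomial_function.intros(4) assms finite)
    with True show ?thesis by (simp add: row_gram_def row_def inner_vec_def)
  next
    case False
    then have "(\<lambda>x. row_gram I (F x) $ i $ j) = (\<lambda>x. if i = j then 1 else 0)"
      by (auto simp: row_gram_def)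
    then show ?thesis by (simp only: real_polynomial_function.intros(2))
  qed
qed

lemma semialgebraic_in_rank_less:
  fixes F H :: "'a::euclidean_space \<Rightarrow> real^'n^'n"
  assumes "\<And>i j. real_polynomial_function (\<lambda>x. F x $ i $ j)" "\<And>i j. real_polynomial_function (\<lambda>x. H x $ i $ j)"
  shows "semialgebraic_in V {x \<in> V. rank (F x) < rank (H x)}"
proof -
  have "{x \<in> V. rank (F x) < rank (H x)} = (\<Union>I. {x \<in> V. det (row_gram I (H x)) \<noteq> 0} \<inter>
      {x \<in> V. \<forall>J\<in>{J. card J = card I}. det (row_gram J (F x)) = 0})"
    unfolding rank_less_iff_row_gram by blast
  moreover have "semialgebraic_in V \<dots>"
    by (intro semialgebraic_in_UN semialgebraic_in.inter semialgebraic_in_nonzero semialgebraic_in_INT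
        semialgebraic_in.zero real_polynomial_function_det_row_gram assms finite)
  ultimately show ?thesis by simp
qed

section \<open>Krylov vectors and semi-algebraicity\<close>

text \<open>The spans of the first m iterates cannot grow strictly more than \<open>DIM('a)\<close>
  times. Once the next iterate lies in the span of the previous ones, that span is invariant and
  contains all iterates.\<close>

lemma Krylov_span_stable:
  fixes f :: "'a::euclidean_space \<Rightarrow> 'a"
  assumes f: "linear f"
  shows "(f ^^ j) z \<in> span ((\<lambda>i. (f ^^ i) z) ` {..<DIM('a)})"
proof -
  define W where "W m = span ((\<lambda>i. (f ^^ i) z) ` {..<m})" for m
  have "\<exists>m\<le>DIM('a). (f ^^ m) z \<in> W m"
  proof (rule ccontr)
    assume n: "\<not> ?thesis"
    have "m \<le> Suc DIM('a) \<Longrightarrow> dim (W m) = m" for m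
    proof (induction m)
      case (Suc m)
      have "(f ^^ m) z \<notin> W m" using n Suc.prems by simp
      then show ?case using Suc unfolding W_def by (simp add: lessThan_Suc dim_insert)
    qed (simp add: W_def)
    then have "dim (W (Suc DIM('a))) = Suc DIM('a)" by simp
    then show False using dim_subset_UNIV[of "W (Suc DIM('a))"] by simp
  qed
  then obtain m where m: "m \<le> DIM('a)" "(f ^^ m) z \<in> W m" by blast
  have inv: "f w \<in> W m" if "w \<in> W m" for w
    using that unfolding W_def
  proof (induction rule: span_induct)
    case base
    show ?case using linear_subspace_vimage[OF f subspace_span] by (simp add: vimage_def)
  next
    case (step w)
    then obtain i where "i < m" "w = (f ^^ i) z" by blast
    then have fw: "f w = (f ^^ Suc i) z" by simp
    show ?case
    proof (cases "Suc i = m")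
      case True
      then show ?thesis using m(2) unfolding fw W_def by simp
    next
      case False
      then have "Suc i \<in> {..<m}" using \<open>i < m\<close> by simp
      then show ?thesis unfolding fw by (intro span_base imageI)
    qed
  qed
  have "(f ^^ j) z \<in> W m"
  proof (induction j)
    case 0
    \<comment> \<open>If m is 0, then \<open>z\<close> lies in the span of the empty set; otherwise
      it is itself a generator.\<close>
    show ?case using m(2) unfolding W_def by (cases m) (auto intro!: span_base image_eqI[of _ _ 0])
  qed (simp add: inv)
  moreover have "W m \<subseteq> W DIM('a)" unfolding W_def using m(1) by (intro span_mono) auto
  ultimately show ?thesis unfolding W_def by blast
qed

text \<open>The vectors orthogonal to all Y^j x form the largest invariant subspace orthogonal to
  \<open>x\<close>. By skew symmetry, orthogonality of \<open>v\<close> to the vectors with j at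
  least 1 says that \<open>Y *v v\<close> lies in it.\<close>

lemma C_set_iff_Krylov:
  "(x, Y) \<in> C_set \<longleftrightarrow> transpose Y = - Y \<and> (\<exists>v. Y *v v \<noteq> 0 \<and> (\<forall>j. v \<bullet> (Y *v (((*v) Y ^^ j) x)) = 0))"
proof (intro iffI conjI; (elim conjE exE)?)
  assume "(x, Y) \<in> C_set"
  then obtain u c where Y: "transpose Y = - Y" and u: "norm u = 1" "c > 0" "Y *v (Y *v u) = - c *\<^sub>R u"
    "u \<bullet> x = 0" "(Y *v u) \<bullet> x = 0"
    by (rule C_setE)
  show "transpose Y = - Y" by (rule Y)
  have "u \<bullet> (((*v) Y ^^ j) x) = 0 \<and> (Y *v u) \<bullet> (((*v) Y ^^ j) x) = 0" for j
  proof (induction j)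
    case (Suc j)
    then show ?case
      using skew_inner[OF Y, of u "((*v) Y ^^ j) x"] skew_inner[OF Y, of "Y *v u" "((*v) Y ^^ j) x"]
      by (simp add: u(3))
  qed (simp add: u)
  then have "u \<bullet> (Y *v (((*v) Y ^^ j) x)) = 0" for j
    using skew_inner[OF Y, of u "((*v) Y ^^ j) x"] by simp
  moreover have "Y *v u \<noteq> 0" using u(1-3) by auto
  ultimately show "\<exists>v. Y *v v \<noteq> 0 \<and> (\<forall>j. v \<bullet> (Y *v (((*v) Y ^^ j) x)) = 0)" by blast
next
  fix v assume Y: "transpose Y = - Y" and v: "Y *v v \<noteq> 0" "\<forall>j. v \<bullet> (Y *v (((*v) Y ^^ j) x)) = 0"
  define E where "E = {w. \<forall>j. w \<bullet> (((*v) Y ^^ j) x) = 0}"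
  have "subspace E" unfolding E_def subspace_def by (simp add: inner_add_left)
  moreover have "Y *v w \<in> E \<and> w \<bullet> x = 0" if "w \<in> E" for w
  proof
    have w: "w \<bullet> (((*v) Y ^^ j) x) = 0" for j using that unfolding E_def by blast
    have "w \<bullet> (Y *v (((*v) Y ^^ j) x)) = 0" for j using w[of "Suc j"] by simp
    then show "Y *v w \<in> E" unfolding E_def by (simp add: skew_inner[OF Y])
    show "w \<bullet> x = 0" using w[of 0] by simp
  qed
  \<comment> \<open>The witness is \<open>Y *v v\<close>, since \<open>v\<close> itself may fail to
    be orthogonal to \<open>x\<close>; it is not in the kernel because \<open>Y\<close> and its
    square have the same kernel.\<close>
  moreover have "Y *v v \<in> E" using v(2) by (simp add: E_def skew_inner[OF Y])
  moreover have "Y *v (Y *v v) \<noteq> 0"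
    using skew_inner[OF Y, of v "Y *v v"] v(1) by auto
  ultimately show "(x, Y) \<in> C_set" unfolding C_set_iff_invariant_subspace using Y by blast
qed

text \<open>Inclusion of the row spaces reverses to inclusion of the kernels, and the rank is
  smaller exactly when the larger kernel is strictly larger.\<close>

lemma rank_less_iff_nullspace:
  fixes K Y :: "real^'n^'n"
  assumes "\<And>i. row i K \<in> span (rows Y)"
  shows "rank K < rank Y \<longleftrightarrow> (\<exists>v. Y *v v \<noteq> 0 \<and> K *v v = 0)"
proof
  have sub: "span (rows K) \<subseteq> span (rows Y)"
    using assms by (intro span_minimal) (auto simp: rows_def)
  show "\<exists>v. Y *v v \<noteq> 0 \<and> K *v v = 0" if "rank K < rank Y"
  proof (rule ccontr)
    assume "\<not> ?thesis"
    then have null: "Y *v v = 0" if "K *v v = 0" for v using that by blast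
    have "inj_on ((*v) K) (span (rows Y))"
    proof (rule inj_onI)
      fix a b assume "a \<in> span (rows Y)" "b \<in> span (rows Y)" "K *v a = K *v b"
      then have "a - b \<in> span (rows Y)" "Y *v (a - b) = 0"
        using null[of "a - b"] by (simp_all add: span_diff matrix_vector_mult_diff_distrib)
      then show "a = b" using nullspace_inter_rowspace[of Y "a - b"] by simp
    qed
    then have "dim ((*v) K ` span (rows Y)) = dim (span (rows Y))"
      by (intro dim_image_eq) (simp_all add: span_span)
    then have "rank Y \<le> rank K"
      unfolding rank_dim_range[of K] row_rank_def[of Y] using dim_subset[of "(*v) K ` span (rows Y)" "range ((*v) K)"]
      by auto
    then show False using that by simp
  qed
  assume "\<exists>v. Y *v v \<noteq> 0 \<and> K *v v = 0"
  then obtain v where v: "Y *v v \<noteq> 0" "K *v v = 0" by blast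
  show "rank K < rank Y"
  proof (rule ccontr)
    assume "\<not> ?thesis"
    then have "span (rows K) = span (rows Y)"
      using subspace_dim_equal[OF subspace_span subspace_span sub] by (simp add: row_rank_def)
    then have "orthogonal v (row i Y)" for i
      using orthogonal_nullspace_rowspace[OF v(2), of "row i Y"] span_base[of "row i Y" "rows Y"]
      by (auto simp: rows_def)
    then have "Y *v v = 0"
      by (simp add: vec_eq_iff matrix_vector_mult_def orthogonal_def row_def inner_vec_def mult.commute)
    then show False using v(1) by simp
  qed
qed

lemma semialgebraic_C_set: "semialgebraic_in G_space (C_set :: ((real^'n) \<times> (real^'n^'n)) set)"
proof -
  \<comment> \<open>Numbering the coordinates lets the Krylov vectors become the rows of a square
    matrix: row \<open>i\<close> of \<open>K\<close> is Y^j x with j = \<open>\<iota> i\<close> + 1,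
    so exactly the exponents from 1 to k occur.\<close>
  obtain \<iota> :: "'n \<Rightarrow> nat" where \<iota>: "bij_betw \<iota> UNIV {..<CARD('n)}"
    using ex_bij_betw_finite_nat[of "UNIV :: 'n set"] by (auto simp: atLeast0LessThan)
  define kry where "kry j p = ((*v) (snd p) ^^ j) (fst p)" for j and p :: "(real^'n) \<times> (real^'n^'n)"
  define K where "K p = (\<chi> i. snd p *v kry (\<iota> i) p)" for p :: "(real^'n) \<times> (real^'n^'n)"
  have Y: "real_polynomial_function (\<lambda>p :: (real^'n) \<times> (real^'n^'n). snd p $ i $ j)" for i j
    by (intro real_polynomial_function.intros(1) bounded_linear_compose[OF bounded_linear_vec_nth]
        bounded_linear_snd)
  have kry: "real_polynomial_function (\<lambda>p. kry j p $ i)" for i j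
    unfolding kry_def
  proof (induction j arbitrary: i)
    case 0
    show ?case
      by (simp, intro real_polynomial_function.intros(1) bounded_linear_compose[OF bounded_linear_vec_nth] bounded_linear_fst)
  next
    case (Suc j)
    then show ?case
      by (simp add: matrix_vector_mult_def)
        (intro real_polynomial_function_sum real_polynomial_function.intros(4) Y finite)
  qed
  have K: "real_polynomial_function (\<lambda>p. K p $ i $ j)" for i j
    unfolding K_def by (simp add: matrix_vector_mult_def)
      (intro real_polynomial_function_sum real_polynomial_function.intros(4) Y kry finite)
  have "(x, Y) \<in> C_set \<longleftrightarrow> rank (K (x, Y)) < rank Y" if skew: "transpose Y = - Y" for x and Y :: "real^'n^'n"
  proof -
    have rowK: "row i (K (x, Y)) = Y *v kry (\<iota> i) (x, Y)" for i
      unfolding K_def row_def by (simp add: vec_eq_iff)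
    have "Y *v a \<in> span (rows Y)" for a
    proof -
      have "Y *v a = transpose Y *v (- a)" unfolding skew by (simp add: matrix_vector_mult_def vec_eq_iff sum_negf)
      also have "\<dots> \<in> span (rows Y)" unfolding transpose_mult_rows
        by (intro span_sum span_scale span_base) (auto simp: rows_def)
      finally show ?thesis .
    qed
    then have "rank (K (x, Y)) < rank Y \<longleftrightarrow> (\<exists>v. Y *v v \<noteq> 0 \<and> K (x, Y) *v v = 0)"
      by (intro rank_less_iff_nullspace) (simp add: rowK)
    moreover have "K (x, Y) *v v = 0 \<longleftrightarrow> (\<forall>j. v \<bullet> (Y *v kry j (x, Y)) = 0)" for v
    proof -
      have "K (x, Y) *v v = 0 \<longleftrightarrow> (\<forall>i. v \<bullet> (Y *v kry (\<iota> i) (x, Y)) = 0)"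
        unfolding rowK[symmetric]
        by (simp add: vec_eq_iff matrix_vector_mult_def row_def inner_vec_def mult.commute)
      also have "\<dots> \<longleftrightarrow> (\<forall>j<CARD('n). v \<bullet> (Y *v kry j (x, Y)) = 0)"
        using \<iota> unfolding bij_betw_def by (metis UNIV_I imageE image_eqI lessThan_iff)
      \<comment> \<open>The first k iterates span all the others, so the finitely many rows of
        \<open>K\<close> test every exponent.\<close>
      also have "\<dots> \<longleftrightarrow> (\<forall>j. v \<bullet> (Y *v kry j (x, Y)) = 0)"
      proof (intro iffI allI)
        fix j assume z: "\<forall>j<CARD('n). v \<bullet> (Y *v kry j (x, Y)) = 0"
        have "subspace {w. v \<bullet> (Y *v w) = 0}"
          by (auto simp: subspace_def matrix_vector_right_distrib matrix_vector_mult_scaleR inner_add_right)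
        then have "span ((\<lambda>i. ((*v) Y ^^ i) x) ` {..<DIM(real^'n)}) \<subseteq> {w. v \<bullet> (Y *v w) = 0}"
          using z by (intro span_minimal) (auto simp: kry_def)
        then show "v \<bullet> (Y *v kry j (x, Y)) = 0"
          using Krylov_span_stable[OF matrix_vector_mul_linear, of j Y x] unfolding kry_def by auto
      qed simp
      finally show ?thesis .
    qed
    ultimately show ?thesis
      unfolding C_set_iff_Krylov using skew by (simp add: kry_def)
  qed
  then have "(x, Y) \<in> C_set \<longleftrightarrow> transpose Y = - Y \<and> rank (K (x, Y)) < rank Y" for x and Y :: "real^'n^'n"
    unfolding C_set_def G_space_def by blast
  then have "C_set = {p \<in> G_space. rank (K p) < rank (snd p)}"
    unfolding G_space_def by auto
  then show ?thesis using semialgebraic_in_rank_less[OF K Y, of G_space] by (simp only:)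
qed


section \<open>Parametrisation by block-diagonal pairs\<close>

definition coord_subspace :: "'n set \<Rightarrow> (real^'n) set" where
  "coord_subspace I = {v. \<forall>i. i \<notin> I \<longrightarrow> v $ i = 0}"

definition block_diag :: "'n set \<Rightarrow> real^'n^'n \<Rightarrow> real^'n^'n" where
  "block_diag I Z = (\<chi> i j. if (i \<in> I) = (j \<in> I) then Z $ i $ j else 0)"

definition block_off :: "'n set \<Rightarrow> real^'n^'n \<Rightarrow> real^'n^'n" where
  "block_off I Z = (\<chi> i j. if (i \<in> I) = (j \<in> I) then 0 else Z $ i $ j)"

definition skew_part :: "real^'n^'n \<Rightarrow> real^'n^'n" where
  "skew_part Z = (\<chi> i j. (Z $ i $ j - Z $ j $ i) / 2)"

definition sym_part :: "real^'n^'n \<Rightarrow> real^'n^'n" where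
  "sym_part Z = (\<chi> i j. (Z $ i $ j + Z $ j $ i) / 2)"

definition frame :: "'n set \<Rightarrow> real^'n^'n \<Rightarrow> real^'n^'n" where
  "frame I Z = mat 1 + block_off I (skew_part Z)"

text \<open>For skew-symmetric \<open>Z\<close> the matrix \<open>A = frame I Z\<close> carries the coordinate plane of \<open>I\<close> and its
  complement to orthogonal subspaces, because \<open>transpose A ** A\<close> is block diagonal.  The summand
  \<open>sym_part Z\<close> vanishes on the skew-symmetric matrices: it only extends the parametrisation to a local
  diffeomorphism of the surrounding space.\<close>

definition block_param :: "'n set \<Rightarrow> (real^'n) \<times> (real^'n^'n) \<Rightarrow> (real^'n) \<times> (real^'n^'n)" where
  "block_param I p = (frame I (snd p) *v fst p,
     frame I (snd p) ** block_diag I (skew_part (snd p)) ** transpose (frame I (snd p)) + sym_part (snd p))"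

text \<open>The parameter space: the off-diagonal blocks of \<open>Z\<close> encode the position of
  the invariant plane, the diagonal blocks the skew-symmetric matrix in adapted coordinates.\<close>

definition split_pairs :: "'n set \<Rightarrow> ((real^'n) \<times> (real^'n^'n)) set" where
  "split_pairs I = {(x, Z). transpose Z = - Z \<and> (\<forall>i\<in>I. x $ i = 0)}"

lemma transpose_eq_uminus_iff: "transpose Z = - Z \<longleftrightarrow> (\<forall>i j. Z $ i $ j = - Z $ j $ i)" for Z :: "real^'n^'n"
  unfolding vec_eq_iff transpose_def vec_lambda_beta uminus_vec_def by blast

lemma skew_part_eq:
  assumes "transpose Z = - Z"
  shows "skew_part Z = Z"
proof -
  have "(Z $ i $ j - Z $ j $ i) / 2 = Z $ i $ j" for i j
    using assms[unfolded transpose_eq_uminus_iff, rule_format, of j i] by simp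
  then show ?thesis by (simp add: skew_part_def vec_eq_iff)
qed

lemma sym_part_eq_0:
  assumes "transpose Z = - Z"
  shows "sym_part Z = 0"
proof -
  have "(Z $ i $ j + Z $ j $ i) / 2 = 0" for i j
    using assms[unfolded transpose_eq_uminus_iff, rule_format, of j i] by simp
  then show ?thesis by (simp add: sym_part_def vec_eq_iff)
qed

lemma transpose_block_off:
  assumes "transpose Z = - Z"
  shows "transpose (block_off I Z) = - block_off I Z"
  unfolding transpose_eq_uminus_iff
proof (intro allI)
  fix i j
  have "Z $ i $ j = - Z $ j $ i" using assms unfolding transpose_eq_uminus_iff by blast
  then show "block_off I Z $ i $ j = - block_off I Z $ j $ i" by (auto simp: block_off_def)
qed

lemma transpose_block_diag:
  assumes "transpose Z = - Z"
  shows "transpose (block_diag I Z) = - block_diag I Z"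
  unfolding transpose_eq_uminus_iff
proof (intro allI)
  fix i j
  have "Z $ i $ j = - Z $ j $ i" using assms unfolding transpose_eq_uminus_iff by blast
  then show "block_diag I Z $ i $ j = - block_diag I Z $ j $ i" by (auto simp: block_diag_def)
qed

lemma subspace_coord_subspace: "subspace (coord_subspace I)"
  by (simp add: coord_subspace_def subspace_def)

lemma coord_subspace_orth: "v \<in> coord_subspace I \<Longrightarrow> w \<in> coord_subspace (- I) \<Longrightarrow> v \<bullet> w = 0"
  unfolding inner_vec_def by (rule sum.neutral) (auto simp: coord_subspace_def)

lemma coord_subspace_decomp:
  obtains v w where "v \<in> coord_subspace I" "w \<in> coord_subspace (- I)" "s = v + w"
proof
  show "(\<chi> i. if i \<in> I then s $ i else 0) \<in> coord_subspace I" "(\<chi> i. if i \<in> I then 0 else s $ i) \<in> coord_subspace (- I)"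
    "s = (\<chi> i. if i \<in> I then s $ i else 0) + (\<chi> i. if i \<in> I then 0 else s $ i)"
    by (auto simp: coord_subspace_def vec_eq_iff)
qed

lemma block_off_Compl: "block_off (- I) Z = block_off I Z"
  by (simp add: block_off_def vec_eq_iff)

lemma block_off_mult:
  assumes "v \<in> coord_subspace I"
  shows "block_off I Z *v v \<in> coord_subspace (- I)"
  unfolding coord_subspace_def mem_Collect_eq matrix_vector_mult_def
  using assms by (auto simp: coord_subspace_def block_off_def intro!: sum.neutral)

lemma block_diag_mult:
  assumes "v \<in> coord_subspace I"
  shows "block_diag I Z *v v \<in> coord_subspace I"
  unfolding coord_subspace_def mem_Collect_eq matrix_vector_mult_def
  using assms by (auto simp: coord_subspace_def block_diag_def intro!: sum.neutral)

lemma frame_mult: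
  assumes "transpose Z = - Z"
  shows "frame I Z *v v = v + block_off I Z *v v" "transpose (frame I Z) *v v = v - block_off I Z *v v"
proof -
  show "frame I Z *v v = v + block_off I Z *v v"
    unfolding frame_def skew_part_eq[OF assms] by (simp add: matrix_vector_mult_add_rdistrib)
  have "transpose (frame I Z) = mat 1 + transpose (block_off I Z)"
    unfolding frame_def skew_part_eq[OF assms] by (simp add: transpose_def mat_def vec_eq_iff eq_commute)
  then have "transpose (frame I Z) = mat 1 - block_off I Z"
    unfolding transpose_block_off[OF assms] by simp
  then show "transpose (frame I Z) *v v = v - block_off I Z *v v"
    by (simp add: matrix_vector_mult_diff_rdistrib)
qed

lemma frame_Compl: "frame (- I) Z = frame I Z"
  by (simp add: frame_def block_off_Compl)

text \<open>For skew-symmetric N the inner product of v with (1 + N) v is the squared norm of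
  v.\<close>

lemma frame_inj:
  assumes Z: "transpose Z = - Z" and "frame I Z *v v = 0"
  shows "v = 0"
proof -
  have "v \<bullet> v = 0"
    using assms(2) skew_inner_self[OF transpose_block_off[OF Z, of I], of v]
    unfolding frame_mult[OF Z] by (metis add.right_neutral inner_add_right inner_zero_right)
  then show ?thesis by simp
qed

text \<open>With N the off-diagonal part, the product is (1 - N)(1 + N) = 1 - N^2. As N exchanges
  the two coordinate subspaces, N^2 preserves each of them.\<close>

lemma frame_gram_mult:
  assumes Z: "transpose Z = - Z" and "v \<in> coord_subspace I"
  shows "transpose (frame I Z) *v (frame I Z *v v) \<in> coord_subspace I"
proof -
  have "transpose (frame I Z) *v (frame I Z *v v) = v - block_off I Z *v (block_off I Z *v v)"
    unfolding frame_mult[OF Z] by (simp add: matrix_vector_right_distrib)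
  moreover have "block_off I Z *v (block_off I Z *v v) \<in> coord_subspace I"
    using block_off_mult[OF block_off_mult[OF assms(2), of Z], of Z] by (simp add: block_off_Compl)
  ultimately show ?thesis using assms(2) subspace_diff[OF subspace_coord_subspace] by simp
qed

lemma frame_orth:
  assumes Z: "transpose Z = - Z" and v: "v \<in> coord_subspace I" and w: "w \<in> coord_subspace (- I)"
  shows "(frame I Z *v v) \<bullet> (frame I Z *v w) = 0"
  using coord_subspace_orth[OF frame_gram_mult[OF Z v] w] inner_transpose_mult by metis

text \<open>Pairing the image of \<open>s\<close> with the component \<open>w\<close> of
  \<open>s\<close> in the complement gives the squared norm of \<open>frame I Z *v w\<close>, which
  must vanish.\<close>

lemma frame_gram_mult_rev:
  assumes Z: "transpose Z = - Z" and s: "transpose (frame I Z) *v (frame I Z *v s) \<in> coord_subspace I"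
  shows "s \<in> coord_subspace I"
proof -
  obtain v w where vw: "v \<in> coord_subspace I" "w \<in> coord_subspace (- I)" "s = v + w"
    by (rule coord_subspace_decomp)
  have "(transpose (frame I Z) *v (frame I Z *v s)) \<bullet> w = (frame I Z *v w) \<bullet> (frame I Z *v w)"
    using frame_orth[OF Z vw(1,2)] unfolding vw(3) inner_transpose_mult
    by (simp add: matrix_vector_right_distrib inner_add_left)
  then have "(frame I Z *v w) \<bullet> (frame I Z *v w) = 0"
    using coord_subspace_orth[OF s vw(2)] by simp
  then have "w = 0" using frame_inj[OF Z] by simp
  with vw show ?thesis by simp
qed

lemma block_param_skew:
  assumes "transpose Z = - Z"
  shows "block_param I (x, Z) = (frame I Z *v x, frame I Z ** block_diag I Z ** transpose (frame I Z))"
  by (simp add: block_param_def skew_part_eq[OF assms] sym_part_eq_0[OF assms])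

lemma transpose_congruence:
  fixes A D :: "real^'n^'n"
  assumes "transpose D = - D"
  shows "transpose (A ** D ** transpose A) = - (A ** D ** transpose A)"
proof -
  have "transpose (A ** D ** transpose A) = A ** transpose D ** transpose A"
    by (simp add: matrix_transpose_mul matrix_mul_assoc)
  also have "\<dots> = - (A ** D ** transpose A)"
    unfolding assms by (intro matrix_mult_eqI)
      (simp add: matrix_vector_mult_uminus linear_neg[OF matrix_vector_mul_linear] flip: matrix_vector_mul_assoc)
  finally show ?thesis .
qed

section \<open>The image of the parametrisation\<close>

text \<open>Write A and D for the frame and the diagonal part. Both D and the Gram matrix of A
  preserve the coordinate plane, so its image under A is invariant under A D A^T; it is orthogonal
  to A x since \<open>x\<close> lies in the complement.\<close>

lemma block_param_in_C_set:
  assumes p: "(x, Z) \<in> split_pairs {a, b}" and ab: "Z $ a $ b \<noteq> 0"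
  shows "block_param {a, b} (x, Z) \<in> C_set"
proof -
  define I where "I = {a, b}"
  define A where "A = frame I Z"
  define D where "D = block_diag I Z"
  define Y where "Y = A ** D ** transpose A"
  have Z: "transpose Z = - Z" and x: "x \<in> coord_subspace (- I)"
    using p unfolding split_pairs_def coord_subspace_def I_def by auto
  have Zij: "Z $ i $ j = - Z $ j $ i" for i j using Z unfolding transpose_eq_uminus_iff by blast
  have "a \<noteq> b" using ab Zij[of a a] by auto
  have YA: "Y *v (A *v v) = A *v (D *v (transpose A *v (A *v v)))" for v
    unfolding Y_def by (simp flip: matrix_vector_mul_assoc)
  define E where "E = (*v) A ` coord_subspace I"
  have "subspace E"
    unfolding E_def by (intro linear_subspace_image matrix_vector_mul_linear subspace_coord_subspace)
  moreover have "Y *v e \<in> E \<and> e \<bullet> (A *v x) = 0" if e: "e \<in> E" for e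
  proof -
    obtain v where v: "e = A *v v" "v \<in> coord_subspace I" using e unfolding E_def by blast
    have "D *v (transpose A *v (A *v v)) \<in> coord_subspace I"
      unfolding A_def D_def by (intro block_diag_mult frame_gram_mult Z v)
    then have "Y *v e \<in> E" unfolding v(1) YA E_def by (rule imageI)
    then show ?thesis using frame_orth[OF Z v(2) x] unfolding v(1) A_def by blast
  qed
  moreover have "\<exists>e\<in>E. Y *v e \<noteq> 0"
  proof (intro bexI notI)
    have e: "axis a 1 \<in> coord_subspace I" by (simp add: coord_subspace_def I_def axis_def)
    then show "A *v axis a 1 \<in> E" unfolding E_def by blast
    define r where "r = transpose A *v (A *v axis a 1)"
    have r: "r \<in> coord_subspace I" unfolding r_def A_def using Z e by (rule frame_gram_mult)
    assume "Y *v (A *v axis a 1) = 0"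
    then have D0: "D *v r = 0" unfolding YA using frame_inj[OF Z] unfolding A_def r_def by blast
    \<comment> \<open>On the plane D is a 2 x 2 skew-symmetric block, invertible because its entry
      \<open>Z $ a $ b\<close> is nonzero.\<close>
    have "(D *v r) $ i = Z $ i $ a * r $ a + Z $ i $ b * r $ b" if "i \<in> I" for i
    proof -
      have "(D *v r) $ i = (\<Sum>j\<in>I. Z $ i $ j * r $ j)"
        unfolding matrix_vector_mult_def vec_lambda_beta using r that
        by (intro sum.mono_neutral_cong_right) (auto simp: D_def block_diag_def coord_subspace_def)
      then show ?thesis using \<open>a \<noteq> b\<close> by (simp add: I_def)
    qed
    then have "Z $ i $ a * r $ a + Z $ i $ b * r $ b = 0" if "i \<in> I" for i
      using that D0 by simp
    from this[of a] this[of b] have "r $ a = 0" "r $ b = 0"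
      using Zij[of a a] Zij[of b b] Zij[of b a] ab by (auto simp: I_def)
    then have "r = 0" using r by (auto simp: coord_subspace_def I_def vec_eq_iff)
    then have "(A *v axis a 1) \<bullet> (A *v axis a 1) = 0"
      unfolding r_def using inner_transpose_mult[of A "A *v axis a 1" "axis a 1"] by simp
    then have "axis a 1 = (0 :: real^'a)" using frame_inj[OF Z] unfolding A_def by (metis inner_eq_zero_iff)
    then show False by simp
  qed
  moreover have "transpose Y = - Y"
    unfolding Y_def by (intro transpose_congruence) (simp add: D_def transpose_block_diag Z)
  ultimately have "(A *v x, Y) \<in> C_set" unfolding C_set_iff_invariant_subspace by blast
  then show ?thesis unfolding block_param_skew[OF Z] Y_def A_def D_def I_def .
qed

text \<open>An invariant plane orthogonal to \<open>x\<close> is the graph of a linear map over some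
  coordinate plane. Completing this map to a skew-symmetric N gives the frame A = 1 + N, and the
  pair is pulled back to A^-1 x and A^-1 Y A^-T.\<close>

lemma C_set_subset_block_param:
  "C_set \<subseteq> (\<Union>(a, b)\<in>{(a, b). a \<noteq> b}. block_param {a, b} ` split_pairs {a, b})"
proof
  fix p :: "(real^'n) \<times> (real^'n^'n)" assume "p \<in> C_set"
  then obtain x Y where p: "p = (x, Y)" "(x, Y) \<in> C_set" by (cases p) auto
  obtain u c where Y: "transpose Y = - Y" and u: "norm u = 1" "c > 0" "Y *v (Y *v u) = - c *\<^sub>R u"
    "u \<bullet> x = 0" "(Y *v u) \<bullet> x = 0"
    using C_setE[OF p(2)] by metis
  define w where "w = Y *v u"
  \<comment> \<open>A nonzero 2 x 2 minor of the independent vectors \<open>u\<close> and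
    \<open>w\<close>: over these two coordinates the plane is a graph.\<close>
  have "\<exists>a b. u $ a * w $ b - u $ b * w $ a \<noteq> 0"
  proof (rule ccontr)
    assume "\<not> ?thesis"
    then have eq: "u $ a * w $ b = u $ b * w $ a" for a b by simp
    have "u \<noteq> 0" using u(1) by auto
    then obtain a where a: "u $ a \<noteq> 0" by (auto simp: vec_eq_iff)
    have "w = (w $ a / u $ a) *\<^sub>R u" using eq a by (simp add: vec_eq_iff field_simps)
    moreover have "u \<bullet> w = 0" unfolding w_def by (rule skew_inner_self[OF Y])
    moreover have "u \<bullet> u = 1" using u(1) by (simp add: norm_eq_1)
    ultimately have "w = 0" by (metis inner_scaleR_right mult.right_neutral scaleR_zero_left)
    then show False using u(1-3) unfolding w_def by auto
  qed
  then obtain a b where "u $ a * w $ b - u $ b * w $ a \<noteq> 0" by blast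
  define \<Delta> where "\<Delta> = u $ a * w $ b - u $ b * w $ a"
  have \<Delta>: "\<Delta> \<noteq> 0" unfolding \<Delta>_def by fact
  then have ab: "a \<noteq> b" unfolding \<Delta>_def by auto
  define I where "I = {a, b}"
  \<comment> \<open>Cramer's rule: the basis of the plane whose coordinates at \<open>a\<close> and
    \<open>b\<close> are (1, 0) and (0, 1).\<close>
  define fa where "fa = (w $ b / \<Delta>) *\<^sub>R u - (u $ b / \<Delta>) *\<^sub>R w"
  define fb where "fb = (u $ a / \<Delta>) *\<^sub>R w - (w $ a / \<Delta>) *\<^sub>R u"
  have fI: "fa $ a = 1" "fa $ b = 0" "fb $ a = 0" "fb $ b = 1"
    unfolding fa_def fb_def using \<Delta> by (simp_all add: field_simps) (simp_all add: \<Delta>_def algebra_simps)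
  \<comment> \<open>Columns \<open>a\<close> and \<open>b\<close> hold the parts of
    \<open>fa\<close> and \<open>fb\<close> outside \<open>I\<close>, so 1 + N sends the two axis
    vectors to \<open>fa\<close> and \<open>fb\<close>; rows \<open>a\<close> and \<open>b\<close>
    make it skew-symmetric.\<close>
  define N :: "real^'n^'n" where "N = (\<chi> i j. if i \<notin> I \<and> j = a then fa $ i else if i \<notin> I \<and> j = b then fb $ i
    else if j \<notin> I \<and> i = a then - fa $ j else if j \<notin> I \<and> i = b then - fb $ j else 0)"
  have N: "transpose N = - N"
    unfolding transpose_eq_uminus_iff N_def using ab by (auto simp: I_def)
  have NI: "N $ i $ j = 0" if "(i \<in> I) = (j \<in> I)" for i j
    using that unfolding N_def I_def by auto
  have offN: "block_off I N = N" using NI by (auto simp: block_off_def vec_eq_iff)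
  define A where "A = frame I N"
  have A_coord: "A *v v = v $ a *\<^sub>R fa + v $ b *\<^sub>R fb" if "v \<in> coord_subspace I" for v
  proof -
    have "(N *v v) $ i = (if i \<in> I then 0 else v $ a * fa $ i + v $ b * fb $ i)" for i
    proof -
      have "(N *v v) $ i = (\<Sum>j\<in>I. N $ i $ j * v $ j)"
        unfolding matrix_vector_mult_def vec_lambda_beta using that
        by (intro sum.mono_neutral_right) (auto simp: coord_subspace_def)
      also have "\<dots> = (if i \<in> I then 0 else v $ a * fa $ i + v $ b * fb $ i)"
        using ab NI[of i a] NI[of i b] by (auto simp: I_def N_def)
      finally show ?thesis .
    qed
    then show ?thesis
      using that fI ab unfolding A_def frame_mult[OF N] offN
      by (auto simp: vec_eq_iff I_def coord_subspace_def)
  qed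
  define W where "W = span {u, w}"
  have fW: "fa \<in> W" "fb \<in> W"
    unfolding fa_def fb_def W_def by (rule span_diff[OF span_scale span_scale]; rule span_base; simp)+
  have uw: "u = u $ a *\<^sub>R fa + u $ b *\<^sub>R fb" "w = w $ a *\<^sub>R fa + w $ b *\<^sub>R fb"
  proof -
    have "u $ i = u $ a * fa $ i + u $ b * fb $ i" "w $ i = w $ a * fa $ i + w $ b * fb $ i" for i
    proof -
      have fai: "\<Delta> * fa $ i = w $ b * u $ i - u $ b * w $ i" "\<Delta> * fb $ i = u $ a * w $ i - w $ a * u $ i"
        unfolding fa_def fb_def using \<Delta> by (simp_all add: right_diff_distrib)
      have "\<Delta> * (u $ a * fa $ i + u $ b * fb $ i) = \<Delta> * u $ i"
        "\<Delta> * (w $ a * fa $ i + w $ b * fb $ i) = \<Delta> * w $ i"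
        unfolding distrib_left mult.left_commute[of \<Delta>] fai by (simp_all add: \<Delta>_def algebra_simps)
      then show "u $ i = u $ a * fa $ i + u $ b * fb $ i" "w $ i = w $ a * fa $ i + w $ b * fb $ i"
        using \<Delta> by simp_all
    qed
    then show "u = u $ a *\<^sub>R fa + u $ b *\<^sub>R fb" "w = w $ a *\<^sub>R fa + w $ b *\<^sub>R fb"
      unfolding vec_eq_iff vector_add_component vector_scaleR_component real_scaleR_def by blast+
  qed
  have AW: "A *v v \<in> W" if "v \<in> coord_subspace I" for v
    unfolding A_coord[OF that] using fW unfolding W_def by (intro span_add span_scale)
  have WA: "\<exists>v\<in>coord_subspace I. z = A *v v" if "z \<in> W" for z
  proof -
    have sub: "subspace ((*v) A ` coord_subspace I)"
      by (intro linear_subspace_image matrix_vector_mul_linear subspace_coord_subspace)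
    have "s $ a *\<^sub>R fa + s $ b *\<^sub>R fb \<in> (*v) A ` coord_subspace I" for s :: "real^'n"
    proof -
      have v: "(\<chi> i. if i \<in> I then s $ i else 0) \<in> coord_subspace I" by (simp add: coord_subspace_def)
      have "A *v (\<chi> i. if i \<in> I then s $ i else 0) = s $ a *\<^sub>R fa + s $ b *\<^sub>R fb"
        unfolding A_coord[OF v] by (simp add: I_def)
      then show ?thesis using imageI[OF v, of "(*v) A"] by (simp only:)
    qed
    from this[of u] this[of w] have "{u, w} \<subseteq> (*v) A ` coord_subspace I"
      unfolding uw[symmetric] by blast
    then have "W \<subseteq> (*v) A ` coord_subspace I" unfolding W_def using sub by (rule span_minimal)
    then show ?thesis using that by blast
  qed
  have YW: "Y *v z \<in> W" if "z \<in> W" for z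
  proof -
    have "{u, w} \<subseteq> {z. Y *v z \<in> W}"
      unfolding W_def using u(3) by (auto simp: intro: span_base span_scale span_neg simp flip: w_def)
    moreover have "subspace {z. Y *v z \<in> W}"
      using linear_subspace_vimage[OF matrix_vector_mul_linear[of Y] subspace_span[of "{u, w}"]]
      unfolding W_def by (simp add: vimage_def)
    ultimately show ?thesis using span_minimal[of "{u, w}" "{z. Y *v z \<in> W}"] that unfolding W_def by blast
  qed
  have Wx: "z \<bullet> x = 0" if "z \<in> W" for z
  proof -
    have "subspace {z. z \<bullet> x = 0}" by (simp add: subspace_def inner_add_left)
    then show ?thesis
      using span_minimal[of "{u, w}" "{z. z \<bullet> x = 0}"] that u(4,5) unfolding W_def w_def by auto
  qed
  obtain B where BA: "B ** A = mat 1"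
    using frame_inj[OF N, of I] unfolding A_def by (metis matrix_left_invertible_ker)
  then have AB: "A ** B = mat 1" using matrix_left_right_inverse by blast
  have BAv: "B *v (A *v v) = v" "A *v (B *v v) = v" "transpose A *v (transpose B *v v) = v" for v
    unfolding matrix_vector_mul_assoc matrix_transpose_mul[symmetric] BA AB
    by (simp_all only: transpose_mat matrix_vector_mul_lid)
  define r where "r = B *v x"
  define D where "D = B ** Y ** transpose B"
  have Dskew: "transpose D = - D" unfolding D_def by (rule transpose_congruence[OF Y])
  \<comment> \<open>The Gram matrix of A sends \<open>r\<close> to \<open>transpose A *v x\<close>,
    whose entries in \<open>I\<close> pair \<open>x\<close> with vectors of the invariant
    plane.\<close>
  have "r \<in> coord_subspace (- I)"
  proof (rule frame_gram_mult_rev[OF N])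
    have "(transpose A *v x) $ i = 0" if "i \<in> I" for i
    proof -
      have "(axis i 1 :: real^'n) \<in> coord_subspace I" using that by (auto simp: coord_subspace_def axis_def)
      from Wx[OF AW[OF this]] have "(transpose A *v x) \<bullet> axis i 1 = 0"
        unfolding inner_transpose_mult by (simp only: inner_commute)
      then show ?thesis by (simp add: inner_axis)
    qed
    then show "transpose (frame (- I) N) *v (frame (- I) N *v r) \<in> coord_subspace (- I)"
      unfolding frame_Compl r_def BAv(2)[unfolded A_def] by (simp add: coord_subspace_def A_def)
  qed
  \<comment> \<open>B B^T inverts the Gram matrix of A and so preserves the coordinate plane.
    Applying A, then \<open>Y\<close>, then B leads from there into the invariant plane, within it,
    and back.\<close>
  have D0: "D $ j $ i = 0" if "i \<in> I" "j \<notin> I" for i j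
  proof -
    have e: "(axis i 1 :: real^'n) \<in> coord_subspace I" using that by (auto simp: coord_subspace_def axis_def)
    define s where "s = B *v (transpose B *v axis i 1)"
    have "s \<in> coord_subspace I"
    proof (rule frame_gram_mult_rev[OF N])
      show "transpose (frame I N) *v (frame I N *v s) \<in> coord_subspace I"
        using e unfolding A_def[symmetric] s_def BAv .
    qed
    then obtain v where v: "v \<in> coord_subspace I" "Y *v (A *v s) = A *v v"
      using WA[OF YW[OF AW]] by blast
    have "D *v axis i 1 = B *v (Y *v (A *v s))"
      unfolding D_def s_def BAv by (simp flip: matrix_vector_mul_assoc)
    then have "D *v axis i 1 = v" unfolding v(2) BAv .
    then have "(D *v axis i 1) $ j = 0" using v(1) that(2) by (simp add: coord_subspace_def)
    then show ?thesis by (simp add: matrix_vector_mult_basis column_def)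
  qed
  \<comment> \<open>\<open>D\<close> and \<open>N\<close> occupy complementary blocks, so both can
    be read off from their sum.\<close>
  define Z where "Z = D + N"
  have skew_ij: "N $ i $ j = - N $ j $ i" "D $ i $ j = - D $ j $ i" for i j
    using N Dskew unfolding transpose_eq_uminus_iff by blast+
  have "Z $ i $ j = - Z $ j $ i" for i j
    using skew_ij[of i j] unfolding Z_def by simp
  then have Z: "transpose Z = - Z" unfolding transpose_eq_uminus_iff by blast
  have Dij: "D $ i $ j = 0" if "(i \<in> I) \<noteq> (j \<in> I)" for i j
    using that D0[of i j] D0[of j i] skew_ij(2)[of i j] by (cases "i \<in> I") auto
  have "block_off I Z = N" "block_diag I Z = D"
    using Dij NI unfolding Z_def block_off_def block_diag_def by (auto simp: vec_eq_iff)
  moreover from this have "frame I Z = A"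
    unfolding frame_def A_def skew_part_eq[OF Z] skew_part_eq[OF N] offN by simp
  ultimately have "block_param I (r, Z) = (A *v r, A ** D ** transpose A)"
    unfolding block_param_skew[OF Z] by simp
  moreover have "A ** D ** transpose A = Y"
  proof -
    have "A ** D ** transpose A = (A ** B) ** Y ** (transpose B ** transpose A)"
      unfolding D_def by (simp add: matrix_mul_assoc)
    then show ?thesis using AB by (simp flip: matrix_transpose_mul)
  qed
  ultimately have "block_param I (r, Z) = p" unfolding p(1) r_def BAv by simp
  moreover have "(r, Z) \<in> split_pairs I"
    using \<open>r \<in> coord_subspace (- I)\<close> Z unfolding split_pairs_def coord_subspace_def by auto
  ultimately have "p \<in> block_param I ` split_pairs I" by (metis imageI)
  then show "p \<in> (\<Union>(a, b)\<in>{(a, b). a \<noteq> b}. block_param {a, b} ` split_pairs {a, b})"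
    using ab unfolding I_def by blast
qed


section \<open>The dimension of \<open>C_set\<close>\<close>

lemma subspace_split_pairs: "subspace (split_pairs I)"
proof -
  have "transpose (A + B) = transpose A + transpose B" "transpose (c *\<^sub>R A) = c *\<^sub>R transpose A"
    "transpose 0 = (0 :: real^'a^'a)" for A B :: "real^'a^'a" and c
    by (simp_all add: transpose_def vec_eq_iff)
  then show ?thesis
    by (auto simp: split_pairs_def subspace_def zero_prod_def)
qed

text \<open>Adjoining the axis vectors at \<open>a\<close> and \<open>b\<close> in the first
  component fills up \<open>G_space\<close>, and each raises the dimension by one.\<close>

lemma dim_split_pairs:
  assumes "a \<noteq> b"
  shows "dim (split_pairs {a, b} :: ((real^'n) \<times> (real^'n^'n)) set) + 2 = dim (G_space :: ((real^'n) \<times> (real^'n^'n)) set)"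
proof -
  define Q where "Q = (split_pairs {a, b} :: ((real^'n) \<times> (real^'n^'n)) set)"
  define e where "e i = ((axis i 1, 0) :: (real^'n) \<times> (real^'n^'n))" for i
  have "subspace {p :: (real^'n) \<times> (real^'n^'n). fst p $ i = 0}" for i
    by (simp add: subspace_def)
  then have min: "span S \<subseteq> {p. fst p $ i = 0}" if "S \<subseteq> {p. fst p $ i = 0}" for S :: "((real^'n) \<times> (real^'n^'n)) set" and i
    using that by (rule span_minimal[rotated])
  have Qab: "Q \<subseteq> {p. fst p $ a = 0}" "Q \<subseteq> {p. fst p $ b = 0}" unfolding Q_def split_pairs_def by auto
  have "e b \<notin> span Q" using min[OF Qab(2)] by (auto simp: e_def)
  moreover have "e a \<notin> span (insert (e b) Q)"
    using min[of "insert (e b) Q" a] Qab(1) assms by (auto simp: e_def axis_def)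
  ultimately have "dim (insert (e a) (insert (e b) Q)) = dim Q + 2"
    by (simp add: dim_insert)
  moreover have "span (insert (e a) (insert (e b) Q)) = G_space"
  proof
    have "e i \<in> G_space" for i
      by (simp add: e_def G_space_def transpose_def vec_eq_iff)
    moreover have "Q \<subseteq> G_space" unfolding Q_def split_pairs_def G_space_def by auto
    ultimately show "span (insert (e a) (insert (e b) Q)) \<subseteq> G_space"
      by (intro span_minimal subspace_G_space) auto
    show "G_space \<subseteq> span (insert (e a) (insert (e b) Q))"
    proof
      fix p :: "(real^'n) \<times> (real^'n^'n)" assume p: "p \<in> G_space"
      define q where "q = p - (fst p $ a *\<^sub>R e a + fst p $ b *\<^sub>R e b)"
      have "q \<in> Q"
        using p assms unfolding q_def Q_def split_pairs_def G_space_def e_def by (auto simp: axis_def split: prod.splits)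
      then have "q + (fst p $ a *\<^sub>R e a + fst p $ b *\<^sub>R e b) \<in> span (insert (e a) (insert (e b) Q))"
        by (intro span_add span_scale span_base) auto
      then show "p \<in> span (insert (e a) (insert (e b) Q))" by (simp add: q_def)
    qed
  qed
  ultimately show ?thesis unfolding Q_def by (metis dim_span)
qed

section \<open>Polynomiality and derivative of the parametrisation\<close>

lemma polynomial_function_vec:
  fixes f :: "'a::euclidean_space \<Rightarrow> 'b::euclidean_space ^ 'n"
  assumes "\<And>i. polynomial_function (\<lambda>x. f x $ i)"
  shows "polynomial_function f"
  using assms unfolding polynomial_function_iff_Basis_inner by (auto simp: Basis_vec_def inner_axis)

lemma polynomial_function_Pair:
  fixes f :: "'a::euclidean_space \<Rightarrow> 'b::euclidean_space" and g :: "'a \<Rightarrow> 'c::euclidean_space"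
  assumes "polynomial_function f" "polynomial_function g"
  shows "polynomial_function (\<lambda>x. (f x, g x))"
  using assms unfolding polynomial_function_iff_Basis_inner by (auto simp: Basis_prod_def)

lemma bounded_linear_block_diag: "bounded_linear (\<lambda>p :: (real^'n) \<times> (real^'n^'n). block_diag I (skew_part (snd p)))"
  unfolding linear_conv_bounded_linear[symmetric]
  by (intro linearI) (simp_all add: block_diag_def skew_part_def vec_eq_iff field_simps)

lemma bounded_linear_block_off: "bounded_linear (\<lambda>p :: (real^'n) \<times> (real^'n^'n). block_off I (skew_part (snd p)))"
  unfolding linear_conv_bounded_linear[symmetric]
  by (intro linearI) (simp_all add: block_off_def skew_part_def vec_eq_iff field_simps)

lemma bounded_linear_sym_part: "bounded_linear (\<lambda>p :: (real^'n) \<times> (real^'n^'n). sym_part (snd p))"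
  unfolding linear_conv_bounded_linear[symmetric]
  by (intro linearI) (simp_all add: sym_part_def vec_eq_iff field_simps)

lemma polynomial_function_block_param: "polynomial_function (block_param (I :: 'n::finite set))"
proof -
  have lin: "real_polynomial_function (\<lambda>p. f p $ i $ j)" if "bounded_linear f" for f :: "(real^'n) \<times> (real^'n^'n) \<Rightarrow> real^'n^'n" and i j
    by (intro real_polynomial_function.intros(1) bounded_linear_compose[OF bounded_linear_vec_nth] that)
  have x: "real_polynomial_function (\<lambda>p :: (real^'n) \<times> (real^'n^'n). fst p $ i)" for i
    by (intro real_polynomial_function.intros(1) bounded_linear_compose[OF bounded_linear_vec_nth] bounded_linear_fst)
  have A: "real_polynomial_function (\<lambda>p :: (real^'n) \<times> (real^'n^'n). frame I (snd p) $ i $ j)" for I :: "'n set" and i j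
    unfolding frame_def vector_add_component
    by (rule real_polynomial_function.intros(3)[OF real_polynomial_function.intros(2) lin[OF bounded_linear_block_off]])
  show ?thesis
    unfolding block_param_def
    by (intro polynomial_function_Pair polynomial_function_vec)
      (simp_all add: matrix_vector_mult_def matrix_matrix_mult_def transpose_def flip: real_polynomial_function_eq,
       (intro real_polynomial_function_sum real_polynomial_function.intros(3,4) A x
         lin[OF bounded_linear_block_diag] lin[OF bounded_linear_sym_part] finite)+)
qed

definition rot_generator :: "'n \<Rightarrow> 'n \<Rightarrow> real^'n^'n" where
  "rot_generator a b = (\<chi> i j. if i = a \<and> j = b then 1 else if i = b \<and> j = a then - 1 else 0)"

lemma mult_rot_generator:
  assumes "a \<noteq> b"
  shows "(M ** rot_generator a b) $ i $ j = (if j = b then M $ i $ a else if j = a then - M $ i $ b else 0)"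
proof -
  have "(M ** rot_generator a b) $ i $ j = (\<Sum>l\<in>UNIV. if l = a then (if j = b then M $ i $ a else 0) else
      if l = b then (if j = a then - M $ i $ b else 0) else 0)"
    unfolding matrix_matrix_mult_def rot_generator_def vec_lambda_beta using assms by (intro sum.cong) auto
  also have "\<dots> = (\<Sum>l\<in>{a, b}. if l = a then (if j = b then M $ i $ a else 0) else
      if l = b then (if j = a then - M $ i $ b else 0) else 0)"
    by (intro sum.mono_neutral_right) auto
  finally show ?thesis using assms by auto
qed

lemma rot_generator_mult:
  assumes "a \<noteq> b"
  shows "(rot_generator a b ** M) $ i $ j = (if i = a then M $ b $ j else if i = b then - M $ a $ j else 0)"
proof -
  have "(rot_generator a b ** M) $ i $ j = (\<Sum>l\<in>UNIV. if l = b then (if i = a then M $ b $ j else 0) else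
      if l = a then (if i = b then - M $ a $ j else 0) else 0)"
    unfolding matrix_matrix_mult_def rot_generator_def vec_lambda_beta using assms by (intro sum.cong) auto
  also have "\<dots> = (\<Sum>l\<in>{a, b}. if l = b then (if i = a then M $ b $ j else 0) else
      if l = a then (if i = b then - M $ a $ j else 0) else 0)"
    by (intro sum.mono_neutral_right) auto
  finally show ?thesis using assms by auto
qed

text \<open>At the base point the frame is the identity and the vector is 0, so varying the frame
  does not affect the first component, and enters the second only through products with the rotation
  generator.\<close>

lemma block_param_has_derivative:
  assumes "a \<noteq> b"
  shows "(block_param {a, b} has_derivative (\<lambda>v. (fst v,
      rot_generator a b ** transpose (block_off {a, b} (skew_part (snd v))) + block_diag {a, b} (skew_part (snd v))
      + block_off {a, b} (skew_part (snd v)) ** rot_generator a b + sym_part (snd v))))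
    (at (0, rot_generator a b))"
proof -
  let ?J = "rot_generator a b" and ?p = "(0, rot_generator a b)"
  let ?N = "\<lambda>p :: (real^'a) \<times> (real^'a^'a). block_off {a, b} (skew_part (snd p))"
  let ?D = "\<lambda>p :: (real^'a) \<times> (real^'a^'a). block_diag {a, b} (skew_part (snd p))"
  have J: "transpose ?J = - ?J"
    unfolding transpose_eq_uminus_iff rot_generator_def using assms by auto
  have J0: "block_off {a, b} (skew_part ?J) = 0" "block_diag {a, b} (skew_part ?J) = ?J" "frame {a, b} ?J = mat 1"
    unfolding frame_def skew_part_eq[OF J]
    by (auto simp: block_off_def block_diag_def rot_generator_def vec_eq_iff)
  have mm: "bounded_bilinear (\<lambda>A B :: real^'a^'a. A ** B)"
    unfolding bilinear_conv_bounded_bilinear[symmetric] bilinear_def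
    by (auto intro!: linearI simp: matrix_matrix_mult_def vec_eq_iff algebra_simps sum.distrib sum_distrib_left)
  have mv: "bounded_bilinear (\<lambda>(A :: real^'a^'a) v. A *v v)"
    unfolding bilinear_conv_bounded_bilinear[symmetric] bilinear_def
    by (auto intro!: linearI simp: matrix_vector_mult_def vec_eq_iff algebra_simps sum.distrib sum_distrib_left)
  have tr: "bounded_linear (transpose :: real^'a^'a \<Rightarrow> real^'a^'a)"
    unfolding linear_conv_bounded_linear[symmetric] by (intro linearI) (simp_all add: transpose_def vec_eq_iff)
  have F: "((\<lambda>p :: (real^'a) \<times> (real^'a^'a). frame {a, b} (snd p)) has_derivative ?N) (at ?p)"
    unfolding frame_def
    using has_derivative_add[OF has_derivative_const bounded_linear_imp_has_derivative[OF bounded_linear_block_off]] by simp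
  have D: "(?D has_derivative ?D) (at ?p)"
    by (rule bounded_linear_imp_has_derivative[OF bounded_linear_block_diag])
  have S: "((\<lambda>p :: (real^'a) \<times> (real^'a^'a). sym_part (snd p)) has_derivative (\<lambda>p. sym_part (snd p))) (at ?p)"
    by (rule bounded_linear_imp_has_derivative[OF bounded_linear_sym_part])
  have fst: "(fst has_derivative fst) (at ?p)"
    by (rule bounded_linear_imp_has_derivative[OF bounded_linear_fst])
  note d = has_derivative_Pair[OF bounded_bilinear.FDERIV[OF mv F fst]
      has_derivative_add[OF bounded_bilinear.FDERIV[OF mm bounded_bilinear.FDERIV[OF mm F D]
        bounded_linear.has_derivative[OF tr F]] S]]
  show ?thesis
    using d unfolding block_param_def[abs_def] by (simp add: J0 add.assoc)
qed

text \<open>On the diagonal blocks the expression is skew part plus symmetric part, that is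
  \<open>Z\<close>. On the others, the symmetric part and the commutator with the generator, which
  is skew-symmetric, vanish separately, and the generator is invertible on the plane.\<close>

lemma block_param_derivative_inj:
  assumes "a \<noteq> b"
    and "rot_generator a b ** transpose (block_off {a, b} (skew_part Z)) + block_diag {a, b} (skew_part Z)
      + block_off {a, b} (skew_part Z) ** rot_generator a b + sym_part Z = 0" (is "?M = 0")
  shows "Z = 0"
proof -
  have M: "?M $ i $ j = 0" for i j using assms(2) by simp
  note simps = mult_rot_generator[OF assms(1)] rot_generator_mult[OF assms(1)] transpose_def block_off_def
    block_diag_def skew_part_def sym_part_def vec_lambda_beta vector_add_component
  have "Z $ i $ a = 0 \<and> Z $ i $ b = 0 \<and> Z $ a $ i = 0 \<and> Z $ b $ i = 0" if "i \<notin> {a, b}" for i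
  proof -
    have "Z $ i $ a + Z $ a $ i = Z $ i $ b - Z $ b $ i" "Z $ a $ i + Z $ i $ a = Z $ b $ i - Z $ i $ b"
      "Z $ i $ b + Z $ b $ i = Z $ a $ i - Z $ i $ a" "Z $ b $ i + Z $ i $ b = Z $ i $ a - Z $ a $ i"
      using M[of i a] M[of a i] M[of i b] M[of b i] that assms(1) unfolding simps by (auto simp: field_simps)
    then show ?thesis by linarith
  qed
  then have "Z $ i $ j = 0 \<and> Z $ j $ i = 0" if "j \<in> {a, b}" "i \<notin> {a, b}" for i j
    using that by auto
  moreover have "Z $ i $ j = 0" if "(i \<in> {a, b}) = (j \<in> {a, b})" for i j
    using M[of i j] that assms(1) unfolding simps by (auto simp: field_simps split: if_splits)
  ultimately have "Z $ i $ j = 0" for i j by blast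
  then show ?thesis by (simp add: vec_eq_iff)
qed

section \<open>The codimension of \<open>C_set\<close>\<close>

theorem proposition8:
  assumes "2 \<le> CARD('n::finite)"
  shows "semialgebraic_in G_space (C_set :: ((real^'n) \<times> (real^'n^'n)) set) \<and>
    has_sa_codim_in G_space (C_set :: ((real^'n) \<times> (real^'n^'n)) set) 2"
proof
  show "semialgebraic_in G_space (C_set :: ((real^'n) \<times> (real^'n^'n)) set)"
    by (rule semialgebraic_C_set)
  \<comment> \<open>The bound on k provides a coordinate plane.\<close>
  obtain a b :: 'n where ab: "a \<noteq> b"
    using assms card_2_iff' obtain_subset_with_card_n[of 2 "UNIV :: 'n set"] by metis
  define g where "g = (block_param {a, b} :: (real^'n) \<times> (real^'n^'n) \<Rightarrow> _)"
  define Q where "Q = (split_pairs {a, b} :: ((real^'n) \<times> (real^'n^'n)) set)"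
  define p :: "(real^'n) \<times> (real^'n^'n)" where "p = (0, rot_generator a b)"
  have "has_sa_dim (C_set :: ((real^'n) \<times> (real^'n^'n)) set) (dim Q)"
    unfolding has_sa_dim_def
  proof (intro conjI allI impI)
    define L where "L v = (fst v,
      rot_generator a b ** transpose (block_off {a, b} (skew_part (snd v))) + block_diag {a, b} (skew_part (snd v))
      + block_off {a, b} (skew_part (snd v)) ** rot_generator a b + sym_part (snd v))" for v :: "(real^'n) \<times> (real^'n^'n)"
    have g: "polynomial_function g" unfolding g_def by (rule polynomial_function_block_param)
    have L: "(g has_derivative L) (at p)"
      unfolding g_def p_def L_def[abs_def] by (rule block_param_has_derivative[OF ab])
    have L0: "v = 0" if "L v = 0" for v
    proof (rule prod_eqI)
      show "fst v = fst 0" using that unfolding L_def zero_prod_def by simp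
      show "snd v = snd 0"
        using that block_param_derivative_inj[OF ab, of "snd v"] unfolding L_def zero_prod_def by simp
    qed
    obtain U V h where UV: "open U" "p \<in> U" "open V" "homeomorphism U V g h" "smooth_on U g" "smooth_on V h"
      by (rule polynomial_local_diffeomorphism[OF g L L0])
    \<comment> \<open>The open condition under which \<open>block_param_in_C_set\<close> applies.
      Pulled back along \<open>h\<close>, it cuts out an open piece of the image of \<open>Q\<close>
      that lies in \<open>C_set\<close>.\<close>
    define X where "X = {q :: (real^'n) \<times> (real^'n^'n). snd q $ a $ b \<noteq> 0}"
    define W where "W = V \<inter> h -` X"
    define S where "S = g ` (Q \<inter> U) \<inter> W"
    have "open X" unfolding X_def by (intro open_Collect_neq continuous_intros)
    then have "open W" unfolding W_def
      using continuous_open_preimage[OF homeomorphism_cont2[OF UV(4)] UV(3)] by blast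
    have "subspace Q" unfolding Q_def by (rule subspace_split_pairs)
    from smooth_submanifold_image[OF UV(1,3-6) this] \<open>open W\<close>
    have "smooth_submanifold (dim Q) S" unfolding S_def by (rule smooth_submanifold_open_Int)
    moreover have hg: "h (g q) = q" if "q \<in> U" for q using homeomorphism_apply1[OF UV(4) that] .
    have "g p \<in> S"
    proof -
      have "p \<in> Q" "p \<in> X" unfolding p_def Q_def X_def split_pairs_def transpose_eq_uminus_iff rot_generator_def
        using ab by auto
      then show ?thesis using UV(2) hg homeomorphism_image1[OF UV(4)] unfolding S_def W_def by auto
    qed
    moreover have "S \<subseteq> C_set"
    proof
      fix y assume "y \<in> S"
      then obtain q where q: "q \<in> Q" "q \<in> U" "y = g q" "h y \<in> X" unfolding S_def W_def by blast
      then have "q \<in> X" using hg by simp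
      with q show "y \<in> C_set"
        unfolding Q_def X_def g_def by (cases q) (auto intro: block_param_in_C_set)
    qed
    ultimately show "\<exists>S. smooth_submanifold (dim Q) S \<and> S \<noteq> {} \<and> S \<subseteq> (C_set :: ((real^'n) \<times> (real^'n^'n)) set)"
      by blast
  next
    fix e and S :: "((real^'n) \<times> (real^'n^'n)) set"
    assume S: "smooth_submanifold e S" "S \<noteq> {}" "S \<subseteq> C_set"
    \<comment> \<open>The parameter spaces of all coordinate planes have the same dimension, so a
      finite cover by their polynomial images bounds \<open>e\<close>.\<close>
    show "e \<le> dim Q"
    proof (rule smooth_submanifold_dim_le[OF S(1,2)])
      show "finite {(a :: 'n, b :: 'n). a \<noteq> b}" by simp
      show "S \<subseteq> (\<Union>i\<in>{(a, b). a \<noteq> b}. block_param {fst i, snd i} ` split_pairs {fst i, snd i})"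
        using S(3) C_set_subset_block_param by (fastforce simp: case_prod_beta)
      show "dim (split_pairs {fst i, snd i} :: ((real^'n) \<times> (real^'n^'n)) set) = dim Q" if "i \<in> {(a, b). a \<noteq> b}" for i
      proof -
        have "fst i \<noteq> snd i" using that by auto
        from dim_split_pairs[OF this] dim_split_pairs[OF ab] show ?thesis unfolding Q_def by linarith
      qed
    qed (auto intro: subspace_split_pairs differentiable_at_polynomial_function polynomial_function_block_param)
  qed
  then show "has_sa_codim_in G_space (C_set :: ((real^'n) \<times> (real^'n^'n)) set) 2"
    unfolding has_sa_codim_in_def Q_def using dim_split_pairs[OF ab] by blast
qed

end
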